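(* If a subset $\mathcal{C}$ of the set $\mathsf{Par}$ of all partitions is regularly linked, then one can algorithmically obtain a $q$-difference equation for $f_{\mathcal{C}}(x,q)=\sum_{\lambda\in\mathcal{C}}x^{\ell(\lambda)}q^{|\lambda|}$. That is, there is an algorithm which, given a 5-tuple $(m,I,\pi,X,X')$ witnessing that $\mathcal{C}$ is regularly linked (with the regular languages $X,X'$ specified by deterministic finite automata), outputs finitely many polynomials $p_0,\dots,p_K\in\mathbb{Q}[x,q]$, not all zero, such that $$\sum_{k=0}^{K}p_k(x,q)\,f_{\mathcal{C}}(xq^{k},q)=0 .$$
   Context: A partition is a finite weakly decreasing sequence $\lambda=(\lambda_1,\dots,\lambda_\ell)$ of positive integers (possibly empty); $\ell(\lambda)=\ell$, $|\lambda|=\sum_i\lambda_i$. $\mathsf{Par}$ is the set of all partitions, $\emptyset_{\mathsf{Par}}$ the empty partition, and $\mathsf{Par}_{\le m}$ the set of partitions all of whose parts are $\le m$. $\lambda\oplus\mu$ is the partition whose multiset of parts is the multiset union of those of $\lambda$ and $\mu$. $\phi_+:\mathsf{Par}\to\mathsf{Par}$ is $\phi_+((\lambda_1,\dots,\lambda_\ell))=(\lambda_1+1,\dots,\lambda_\ell+1)$. For a nonempty finite set $I$, $I^*$ is the set of finite words over $I$, $\varepsilon$ the empty word, $I^+=I^*\setminus\{\varepsilon\}$. A language $X\subseteq I^*$ is regular if it is recognized by a deterministic finite automaton (DFA) over $I$. For a map $\pi:I\to\mathsf{Par}_{\le m}$ ($m\ge1$), $\mathsf{Seq}(I,\pi)$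 is the set of infinite sequences $(i_1,i_2,\dots)$ in $I$ with $\pi(i_j)\ne\emptyset_{\mathsf{Par}}$ for only finitely many $j$, and $\pi^\bullet:\mathsf{Seq}(I,\pi)\to\mathsf{Par}$ is $\pi^\bullet(i_1,i_2,i_3,\dots)=\pi(i_1)\oplus\phi_+^m(\pi(i_2))\oplus\phi_+^{2m}(\pi(i_3))\oplus\cdots$. An infinite sequence matches a word $j_1\cdots j_n$ ($n\ge1$) if the word occurs as a block of consecutive entries; it begins with the word if the word is its initial block. For $S\subseteq I^{\mathbb{Z}_{\ge1}}$ and $X,X'\subseteq I^+$, $\mathsf{avoid}(S,X,X')$ is the set of $\vec{i}\in S$ that match no word of $X$ and begin with no word of $X'$. A subset $\mathcal{C}\subseteq\mathsf{Par}$ is regularly linked if there exist an integer $m>0$, a nonempty finite set $I$, an injective map $\pi:I\to\mathsf{Par}_{\le m}$ and regular languages $X,X'\subseteq I^+$ such that $\pi^\bullet(\mathsf{avoid}(\mathsf{Seq}(I,\pi),X,X'))=\mathcal{C}$. *)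

theory Defs
  imports
    "HOL-Computational_Algebra.Polynomial_FPS"
    "HOL-Library.Nat_Bijection"
    "HOL-Library.FuncSet"
begin

section \<open>Partitions\<close>

definition Par :: "nat list set" where
  "Par = {\<alpha>. sorted_wrt (\<ge>) \<alpha> \<and> (\<forall>p\<in>set \<alpha>. 0 < p)}"

definition Par_le :: "nat \<Rightarrow> nat list set" where
  "Par_le m = {\<alpha>\<in>Par. \<forall>p\<in>set \<alpha>. p \<le> m}"

definition oplus :: "nat list \<Rightarrow> nat list \<Rightarrow> nat list"  (infixr \<open>\<oplus>\<close> 65) where
  "\<alpha> \<oplus> \<beta> = rev (sort (\<alpha> @ \<beta>))"

definition phi_plus :: "nat list \<Rightarrow> nat list" where
  "phi_plus \<alpha> = map Suc \<alpha>"


section \<open>Infinite sequences\<close>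

text \<open>
  A sequence $(i_1, i_2, \dots)$ is a function on \<^typ>\<open>nat\<close> whose value at \<open>j\<close> is $i_{j+1}$.
  Alphabets are finite sets of natural numbers, as an algorithm has to receive their letters
  as finite data.
\<close>

definition Seq :: "nat set \<Rightarrow> (nat \<Rightarrow> nat list) \<Rightarrow> (nat \<Rightarrow> nat) set" where
  "Seq I \<pi> = {s. (\<forall>j. s j \<in> I) \<and> finite {j. \<pi> (s j) \<noteq> []}}"

text \<open>
  On \<open>Seq I \<pi>\<close> all summands of the infinite $\oplus$-sum from some index \<open>N\<close> on are empty, and
  the sum is the finite one over the indices below the least such \<open>N\<close>.
\<close>

definition pi_bullet :: "nat \<Rightarrow> (nat \<Rightarrow> nat list) \<Rightarrow> (nat \<Rightarrow> nat) \<Rightarrow> nat list" where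
  "pi_bullet m \<pi> s =
     foldr (\<oplus>) (map (\<lambda>j. (phi_plus ^^ (m * j)) (\<pi> (s j)))
                   [0..<LEAST N. \<forall>j\<ge>N. \<pi> (s j) = []]) []"

definition matches :: "(nat \<Rightarrow> nat) \<Rightarrow> nat list \<Rightarrow> bool" where
  "matches s w \<longleftrightarrow> (\<exists>a. map s [a..<a + length w] = w)"

definition begins_with :: "(nat \<Rightarrow> nat) \<Rightarrow> nat list \<Rightarrow> bool" where
  "begins_with s w \<longleftrightarrow> map s [0..<length w] = w"

definition avoid :: "(nat \<Rightarrow> nat) set \<Rightarrow> nat list set \<Rightarrow> nat list set \<Rightarrow> (nat \<Rightarrow> nat) set" where
  "avoid S X X' = {s\<in>S. (\<forall>w\<in>X. \<not> matches s w) \<and> (\<forall>w\<in>X'. \<not> begins_with s w)}"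


section \<open>Regular languages and regularly linked sets\<close>

record dfa =
  dfa_states :: "nat set"
  dfa_init :: nat
  dfa_final :: "nat set"
  dfa_step :: "nat \<Rightarrow> nat \<Rightarrow> nat"

definition is_dfa :: "nat set \<Rightarrow> dfa \<Rightarrow> bool" where
  "is_dfa I M \<longleftrightarrow> finite (dfa_states M) \<and> dfa_init M \<in> dfa_states M \<and>
     dfa_final M \<subseteq> dfa_states M \<and> (\<forall>p\<in>dfa_states M. \<forall>i\<in>I. dfa_step M p i \<in> dfa_states M)"

definition dfa_lang :: "nat set \<Rightarrow> dfa \<Rightarrow> nat list set" where
  "dfa_lang I M = {w\<in>lists I. foldl (dfa_step M) (dfa_init M) w \<in> dfa_final M}"

definition recognizes :: "nat set \<Rightarrow> dfa \<Rightarrow> nat list set \<Rightarrow> bool" where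
  "recognizes I M X \<longleftrightarrow> is_dfa I M \<and> dfa_lang I M = X"

definition regular :: "nat set \<Rightarrow> nat list set \<Rightarrow> bool" where
  "regular I X \<longleftrightarrow> (\<exists>M. recognizes I M X)"

definition regularly_linked_by ::
  "nat list set \<Rightarrow> nat \<Rightarrow> nat set \<Rightarrow> (nat \<Rightarrow> nat list) \<Rightarrow> nat list set \<Rightarrow> nat list set \<Rightarrow> bool" where
  "regularly_linked_by C m I \<pi> X X' \<longleftrightarrow>
     0 < m \<and> finite I \<and> I \<noteq> {} \<and> \<pi> \<in> I \<rightarrow> Par_le m \<and> inj_on \<pi> I \<and>
     regular I X \<and> X \<subseteq> lists I - {[]} \<and> regular I X' \<and> X' \<subseteq> lists I - {[]} \<and>
     pi_bullet m \<pi> ` avoid (Seq I \<pi>) X X' = C"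

definition regularly_linked :: "nat list set \<Rightarrow> bool" where
  "regularly_linked C \<longleftrightarrow> (\<exists>m I \<pi> X X'. regularly_linked_by C m I \<pi> X X')"


section \<open>$q$-difference equations\<close>

text \<open>
  Elements of $\mathbb{Q}[x,q]$ and $\mathbb{Q}[[x,q]]$ are polynomials, respectively power series,
  in the outer variable $x$ whose coefficients are polynomials, respectively power series, in the
  inner variable $q$.  The coefficient of $x^a q^n$ in $f_C$ counts a finite set.
\<close>

definition gen_fun :: "nat list set \<Rightarrow> rat fps fps" where
  "gen_fun C = Abs_fps (\<lambda>a. Abs_fps (\<lambda>n. of_nat (card {\<alpha>\<in>C. length \<alpha> = a \<and> sum_list \<alpha> = n})))"

lemma gen_fun_finite:
  assumes "finite C"
  shows "gen_fun C = (\<Sum>\<alpha>\<in>C. fps_X ^ length \<alpha> * fps_const (fps_X ^ sum_list \<alpha>))"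
proof (intro fps_ext)
  fix a n
  have "fps_nth (fps_nth (gen_fun C) a) n = (\<Sum>\<alpha>\<in>C. if length \<alpha> = a \<and> sum_list \<alpha> = n then 1 else 0)"
    using assms by (simp add: gen_fun_def sum.If_cases Int_def)
  also have "\<dots> = (\<Sum>\<alpha>\<in>C. fps_nth (fps_nth (fps_X ^ length \<alpha> * fps_const (fps_X ^ sum_list \<alpha>)) a) n)"
    by (intro sum.cong) (auto simp: fps_X_power_iff)
  finally show "fps_nth (fps_nth (gen_fun C) a) n =
      fps_nth (fps_nth (\<Sum>\<alpha>\<in>C. fps_X ^ length \<alpha> * fps_const (fps_X ^ sum_list \<alpha>)) a) n"
    by (simp add: fps_sum_nth)
qed

definition fps_of_poly2 :: "rat poly poly \<Rightarrow> rat fps fps" where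
  "fps_of_poly2 p = fps_of_poly (map_poly fps_of_poly p)"

text \<open>The power series $F(x q^k, q)$.\<close>

definition q_shift :: "nat \<Rightarrow> rat fps fps \<Rightarrow> rat fps fps" where
  "q_shift k F = fps_compose F (fps_const (fps_X ^ k) * fps_X)"

definition q_difference_equation :: "rat poly poly list \<Rightarrow> rat fps fps \<Rightarrow> bool" where
  "q_difference_equation ps F \<longleftrightarrow>
     (\<exists>k<length ps. ps ! k \<noteq> 0) \<and> (\<Sum>k<length ps. fps_of_poly2 (ps ! k) * q_shift k F) = 0"


section \<open>Algorithms\<close>

text \<open>
  Kleene's general recursive functions: \<open>general_recursive n f\<close> says that \<open>f\<close>, restricted to lists
  of length \<open>n\<close>, is a total recursive function of \<open>n\<close> arguments.  Minimization is applied to regular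
  functions only, so that it always terminates.
\<close>

inductive general_recursive :: "nat \<Rightarrow> (nat list \<Rightarrow> nat) \<Rightarrow> bool" where
  zero: "general_recursive n (\<lambda>xs. 0)"
| succ: "general_recursive 1 (\<lambda>xs. Suc (hd xs))"
| proj: "k < n \<Longrightarrow> general_recursive n (\<lambda>xs. xs ! k)"
| comp: "general_recursive (length gs) f \<Longrightarrow> \<forall>g\<in>set gs. general_recursive n g \<Longrightarrow>
    general_recursive n (\<lambda>xs. f (map (\<lambda>g. g xs) gs))"
| prim_rec: "general_recursive n f \<Longrightarrow> general_recursive (Suc (Suc n)) g \<Longrightarrow>
    general_recursive (Suc n) (\<lambda>xs. rec_nat (f (tl xs)) (\<lambda>k r. g (k # r # tl xs)) (hd xs))"
| minimize: "general_recursive (Suc n) f \<Longrightarrow> \<forall>xs. length xs = n \<longrightarrow> (\<exists>y. f (y # xs) = 0) \<Longrightarrow>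
    general_recursive n (\<lambda>xs. LEAST y. f (y # xs) = 0)"

definition computable :: "(nat \<Rightarrow> nat) \<Rightarrow> bool" where
  "computable A \<longleftrightarrow> (\<exists>f. general_recursive 1 f \<and> (\<forall>x. A x = f [x]))"

text \<open>
  Inputs and outputs are finite objects, written down as natural numbers by means of the effective
  bijections \<^const>\<open>prod_encode\<close>, \<^const>\<open>int_encode\<close> and \<^const>\<open>list_encode\<close>.
  Finite sets are listed in increasing order, and functions on them are given by their tables of
  values in that order.
\<close>

definition encode_set :: "nat set \<Rightarrow> nat" where
  "encode_set S = list_encode (sorted_list_of_set S)"

definition encode_fun :: "nat set \<Rightarrow> (nat \<Rightarrow> nat) \<Rightarrow> nat" where
  "encode_fun S f = list_encode (map f (sorted_list_of_set S))"

definition encode_dfa :: "nat set \<Rightarrow> dfa \<Rightarrow> nat" where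
  "encode_dfa I M = list_encode
     [encode_set (dfa_states M), dfa_init M, encode_set (dfa_final M),
      encode_fun (dfa_states M) (\<lambda>p. encode_fun I (dfa_step M p))]"

definition encode_input :: "nat \<Rightarrow> nat set \<Rightarrow> (nat \<Rightarrow> nat list) \<Rightarrow> dfa \<Rightarrow> dfa \<Rightarrow> nat" where
  "encode_input m I \<pi> M M' = list_encode
     [m, encode_set I, encode_fun I (\<lambda>i. list_encode (\<pi> i)), encode_dfa I M, encode_dfa I M']"

definition encode_rat :: "rat \<Rightarrow> nat" where
  "encode_rat r = (case quotient_of r of (a, b) \<Rightarrow> prod_encode (int_encode a, int_encode b))"

definition encode_poly :: "('a::zero \<Rightarrow> nat) \<Rightarrow> 'a poly \<Rightarrow> nat" where
  "encode_poly enc p = list_encode (map enc (coeffs p))"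

definition encode_output :: "rat poly poly list \<Rightarrow> nat" where
  "encode_output ps = list_encode (map (encode_poly (encode_poly encode_rat)) ps)"

end

theory Submission
  imports Defs
begin

text \<open>
  The sequences in \<open>avoid (Seq I \<pi>) X X'\<close> are those along which a finite automaton, a subset
  automaton for the blocks in \<open>X\<close> paired with the automaton of \<open>X'\<close>, never gets stuck. For a state
  \<open>v\<close> let $F_v$ be the generating function of the sequences that survive from \<open>v\<close>. Reading one letter
  gives $F_v(x) = \sum_i x^{\ell(\pi(i))} q^{|\pi(i)|} F_{v \cdot i}(x q^m)$. Iterating this, all of
  $F_v(x), F_v(x q^m), \dots, F_v(x q^{(K-1)m})$ become combinations of the $F_u(x q^{Km})$ with
  coefficients in $\mathbb{Z}[x,q]$. If \<open>K\<close> exceeds the number of states, the coefficient vectors are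
  linearly dependent, and a dependence is a $q$-difference equation. Whether given polynomials
  are such a dependence is a finite computation on integer coefficients, so that an unbounded
  search finds one.
\<close>

section \<open>Recursive functions\<close>

text \<open>All shifts F_v(x q^(j m)) are pushed forward to the common shift x q^(K m), which takes
  substitutions only. No quotient arises, and elimination without division keeps the coefficients
  polynomial. The cancellation found is one of formal terms over the vertices. It therefore holds
  for whatever series satisfy the functional equations, and its existence can be tested on indicator
  functions of vertices.

  The main obstacle is that minimization may be applied only if it ends for every argument,
  including numbers that encode no input. Hence the graph is read off from an arbitrary number by
  total lookups, the start lies in a finite set of states closed under its edges for every number,
  and valid input is assumed for the correctness of the output alone.

  A second point is that f_C counts partitions while the recursion runs over sequences. The two
  counts agree because \<open>pi_bullet\<close> is injective: \<open>\<pi>\<close> is injective and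
  its parts are at most \<open>m\<close>, so the summands occupy disjoint ranges of part
  sizes.\<close>

definition grec :: "nat \<Rightarrow> (nat list \<Rightarrow> nat) \<Rightarrow> bool" where
  "grec n F \<longleftrightarrow> (\<exists>f. general_recursive n f \<and> (\<forall>xs. length xs = n \<longrightarrow> F xs = f xs))"

abbreviation grec1 :: "(nat \<Rightarrow> nat) \<Rightarrow> bool" where
  "grec1 A \<equiv> grec 1 (\<lambda>xs. A (xs ! 0))"

abbreviation grec2 :: "(nat \<Rightarrow> nat \<Rightarrow> nat) \<Rightarrow> bool" where
  "grec2 B \<equiv> grec 2 (\<lambda>xs. B (xs ! 0) (xs ! 1))"

lemma length_1_conv: "length xs = 1 \<longleftrightarrow> (\<exists>x. xs = [x])"
  by (auto simp: length_Suc_conv)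

lemma computable_iff_grec1: "computable A \<longleftrightarrow> grec1 A"
proof
  assume "computable A"
  then show "grec1 A"
    unfolding computable_def grec_def length_1_conv by auto
next
  assume "grec1 A"
  then obtain f where f: "general_recursive 1 f" "\<And>xs. length xs = 1 \<Longrightarrow> A (xs ! 0) = f xs"
    unfolding grec_def by auto
  have "A x = f [x]" for x
    using f(2)[of "[x]"] by simp
  with f(1) show "computable A"
    unfolding computable_def by auto
qed

text \<open>Agreement on lists of length \<open>n\<close> is all that \<open>grec\<close> asks for;
  this makes, for instance, \<open>xs ! 0\<close> and \<open>hd xs\<close> interchangeable.\<close>

lemma grec_cong: "(\<And>xs. length xs = n \<Longrightarrow> F xs = G xs) \<Longrightarrow> grec n F \<longleftrightarrow> grec n G"
  unfolding grec_def by simp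

lemma grec_proj: "k < n \<Longrightarrow> grec n (\<lambda>xs. xs ! k)"
  unfolding grec_def using general_recursive.proj by blast

lemma grec_comp:
  assumes "grec (length Gs) F" "\<And>G. G \<in> set Gs \<Longrightarrow> grec n G"
  shows "grec n (\<lambda>xs. F (map (\<lambda>G. G xs) Gs))"
proof -
  obtain f where f: "general_recursive (length Gs) f" "\<And>xs. length xs = length Gs \<Longrightarrow> F xs = f xs"
    using assms(1) unfolding grec_def by auto
  have "\<exists>g. general_recursive n g \<and> (\<forall>xs. length xs = n \<longrightarrow> G xs = g xs)" if "G \<in> set Gs" for G
    using assms(2)[OF that] unfolding grec_def .
  then obtain h where h: "\<And>G. G \<in> set Gs \<Longrightarrow>
      general_recursive n (h G) \<and> (\<forall>xs. length xs = n \<longrightarrow> G xs = h G xs)"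
    by metis
  have "general_recursive n (\<lambda>xs. f (map (\<lambda>g. g xs) (map h Gs)))"
    using f(1) h by (intro general_recursive.comp) auto
  moreover have "F (map (\<lambda>G. G xs) Gs) = f (map (\<lambda>g. g xs) (map h Gs))" if "length xs = n" for xs
  proof -
    have "map (\<lambda>G. G xs) Gs = map (\<lambda>g. g xs) (map h Gs)"
      using h that by simp
    then show ?thesis
      by (metis f(2) length_map)
  qed
  ultimately show ?thesis
    unfolding grec_def by blast
qed

lemma grec_comp1: "grec1 A \<Longrightarrow> grec n G \<Longrightarrow> grec n (\<lambda>xs. A (G xs))"
  using grec_comp[of "[G]" "\<lambda>xs. A (xs ! 0)" n] by auto

lemma grec_comp2: "grec2 B \<Longrightarrow> grec n G \<Longrightarrow> grec n H \<Longrightarrow> grec n (\<lambda>xs. B (G xs) (H xs))"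
  using grec_comp[of "[G, H]" "\<lambda>xs. B (xs ! 0) (xs ! 1)" n] by (auto simp: numeral_2_eq_2)

lemma grec_Suc: "grec1 Suc"
  unfolding grec_def length_1_conv
  using general_recursive.succ by (intro exI[of _ "\<lambda>xs. Suc (hd xs)"]) auto

lemma grec_const: "grec n (\<lambda>xs. c)"
proof (induction c)
  case 0
  show ?case
    unfolding grec_def using general_recursive.zero by blast
next
  case (Suc c)
  then show ?case
    by (rule grec_comp1[OF grec_Suc])
qed

lemma grec_rec:
  assumes "grec n F" "grec (Suc (Suc n)) G"
  shows "grec (Suc n) (\<lambda>xs. rec_nat (F (tl xs)) (\<lambda>k r. G (k # r # tl xs)) (hd xs))"
proof -
  obtain f where f: "general_recursive n f" "\<And>xs. length xs = n \<Longrightarrow> F xs = f xs"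
    using assms(1) unfolding grec_def by auto
  obtain g where g: "general_recursive (Suc (Suc n)) g" "\<And>xs. length xs = Suc (Suc n) \<Longrightarrow> G xs = g xs"
    using assms(2) unfolding grec_def by auto
  have "rec_nat (F (tl xs)) (\<lambda>k r. G (k # r # tl xs)) m = rec_nat (f (tl xs)) (\<lambda>k r. g (k # r # tl xs)) m"
    if "length xs = Suc n" for xs m
    using that by (induction m) (auto simp: f g)
  with general_recursive.prim_rec[OF f(1) g(1)] show ?thesis
    unfolding grec_def by blast
qed

lemma grec1_rec:
  assumes "grec2 G"
  shows "grec1 (rec_nat c G)"
proof -
  have "grec (Suc 0) (\<lambda>xs. rec_nat c (\<lambda>k r. G k r) (hd xs))"
    using grec_rec[OF grec_const[of 0 c], of "\<lambda>xs. G (xs ! 0) (xs ! 1)"] assms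
    by (simp add: numeral_2_eq_2)
  then show ?thesis
    by (subst grec_cong[of _ _ "\<lambda>xs. rec_nat c G (hd xs)"]) (auto simp: length_Suc_conv)
qed

lemma grec2_rec:
  assumes "grec1 F" "grec 3 (\<lambda>xs. G (xs ! 0) (xs ! 1) (xs ! 2))"
  shows "grec2 (\<lambda>n x. rec_nat (F x) (\<lambda>k r. G k r x) n)"
proof -
  have "grec (Suc 1) (\<lambda>xs. rec_nat (F (tl xs ! 0)) (\<lambda>k r. G k r (tl xs ! 0)) (hd xs))"
    using grec_rec[OF assms(1), of "\<lambda>xs. G (xs ! 0) (xs ! 1) (xs ! 2)"] assms(2)
    by (simp add: numeral_2_eq_2 numeral_3_eq_3)
  then show ?thesis
    by (subst grec_cong[of _ _ "\<lambda>xs. rec_nat (F (tl xs ! 0)) (\<lambda>k r. G k r (tl xs ! 0)) (hd xs)"])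
      (auto simp: length_Suc_conv numeral_2_eq_2)
qed

lemma grec_least:
  assumes "grec2 B" "\<And>x. \<exists>y. B y x = 0"
  shows "grec1 (\<lambda>x. LEAST y. B y x = 0)"
proof -
  obtain f where f: "general_recursive 2 f" "\<And>xs. length xs = 2 \<Longrightarrow> B (xs ! 0) (xs ! 1) = f xs"
    using assms(1) unfolding grec_def by auto
  have eq: "f [y, x] = B y x" for x y
    using f(2)[of "[y, x]"] by simp
  have "general_recursive 1 (\<lambda>xs. LEAST y. f (y # xs) = 0)"
    using f(1) assms(2) eq
    by (intro general_recursive.minimize) (auto simp: numeral_2_eq_2 length_Suc_conv)
  then show ?thesis
    unfolding grec_def using eq by (auto simp: length_Suc_conv)
qed

section \<open>Arithmetic and the pairing function\<close>

lemma grec_pred: "grec1 (\<lambda>n. n - 1)"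
proof -
  have eq: "n - 1 = rec_nat 0 (\<lambda>k r. k) n" for n :: nat
    by (cases n) auto
  show ?thesis
    unfolding eq by (intro grec1_rec grec_proj) simp
qed

lemma grec_add: "grec2 (+)"
proof -
  have eq: "n + x = rec_nat x (\<lambda>k r. Suc r) n" for n x :: nat
    by (induction n) auto
  show ?thesis
    unfolding eq by (intro grec2_rec grec_proj grec_comp1[OF grec_Suc]) auto
qed

lemma grec_diff: "grec2 (-)"
proof -
  have eq: "x - n = rec_nat x (\<lambda>k r. r - 1) n" for n x :: nat
    by (induction n) (auto)
  \<comment> \<open>\<open>grec2_rec\<close> recurses on the first argument, here the subtrahend;
    the projections at the end restore the order.\<close>
  have "grec2 (\<lambda>n x. rec_nat x (\<lambda>k r. r - 1) n)"
    by (intro grec2_rec grec_proj grec_comp1[OF grec_pred]) auto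
  then have "grec2 (\<lambda>n x. x - n)"
    unfolding eq[symmetric] .
  from grec_comp2[OF this grec_proj[of 1 2] grec_proj[of 0 2]] show ?thesis
    by simp
qed

lemma grec_triangle: "grec1 triangle"
proof -
  have "triangle = rec_nat 0 (\<lambda>k r. r + Suc k)"
  proof
    fix n :: nat
    show "triangle n = rec_nat 0 (\<lambda>k r. r + Suc k) n" by (induction n) auto
  qed
  moreover have "grec1 (rec_nat 0 (\<lambda>k r. r + Suc k))"
    by (intro grec1_rec grec_comp2[OF grec_add] grec_comp1[OF grec_Suc] grec_proj) auto
  ultimately show ?thesis by simp
qed

lemma grec_prod_encode: "grec2 (\<lambda>a b. prod_encode (a, b))"
  unfolding prod_encode_def prod.case
  by (intro grec_comp2[OF grec_add] grec_comp1[OF grec_triangle] grec_proj) auto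

lemma triangle_mono: "a \<le> b \<Longrightarrow> triangle a \<le> triangle b"
  by (induction b) (auto simp: le_Suc_eq)

text \<open>The code of \<open>(a, b)\<close> is the triangular number of the diagonal
  \<open>a + b\<close> plus the offset \<open>a\<close>, so the diagonal is the first
  \<open>s\<close> for which the next triangular number exceeds the code. Truncated subtraction
  states this inequality as an equation with 0, the form that minimization takes.\<close>

lemma prod_encode_sum:
  "(LEAST s. Suc (prod_encode (a, b)) - triangle (Suc s) = 0) = a + b"
proof (rule Least_equality)
  show "Suc (prod_encode (a, b)) - triangle (Suc (a + b)) = 0"
    by (simp add: prod_encode_def)
next
  fix s assume s: "Suc (prod_encode (a, b)) - triangle (Suc s) = 0"
  show "a + b \<le> s"
  proof (rule ccontr)
    assume "\<not> a + b \<le> s"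
    then have "triangle (Suc s) \<le> triangle (a + b)"
      by (intro triangle_mono) simp
    with s show False by (simp add: prod_encode_def)
  qed
qed

lemma grec_prod_decode:
  "grec1 (\<lambda>n. fst (prod_decode n))" "grec1 (\<lambda>n. snd (prod_decode n))"
proof -
  define S where "S n = (LEAST s. Suc n - triangle (Suc s) = 0)" for n
  have S: "S n = fst (prod_decode n) + snd (prod_decode n)" for n
    unfolding S_def using prod_encode_sum[of "fst (prod_decode n)" "snd (prod_decode n)"] by simp
  have n: "n = triangle (S n) + fst (prod_decode n)" for n
  proof -
    have "n = prod_encode (prod_decode n)" by simp
    also have "\<dots> = triangle (S n) + fst (prod_decode n)"
      by (simp add: prod_encode_def S split: prod.splits)
    finally show ?thesis .
  qed
  have "\<exists>s. Suc x - triangle (Suc s) = 0" for x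
    by (rule exI[of _ x]) simp
  moreover have "grec2 (\<lambda>s n. Suc n - triangle (Suc s))"
    by (intro grec_comp2[OF grec_diff] grec_comp1[OF grec_Suc] grec_comp1[OF grec_triangle]
        grec_proj) auto
  ultimately have S': "grec1 S"
    unfolding S_def by (intro grec_least) auto
  have 1: "fst (prod_decode n) = n - triangle (S n)" for n
    using n[of n] by linarith
  have "grec1 (\<lambda>n. n - triangle (S n))"
    by (intro grec_comp2[OF grec_diff] grec_comp1[OF S'] grec_comp1[OF grec_triangle] grec_proj) auto
  then show fst: "grec1 (\<lambda>n. fst (prod_decode n))"
    by (simp only: 1)
  have 2: "snd (prod_decode n) = S n - fst (prod_decode n)" for n
    using S[of n] by linarith
  have "grec1 (\<lambda>n. S n - fst (prod_decode n))"
    by (intro grec_comp2[OF grec_diff] grec_comp1[OF S'] grec_comp1[OF fst] grec_proj) auto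
  then show "grec1 (\<lambda>n. snd (prod_decode n))"
    by (simp only: 2)
qed


section \<open>Computable functions between encodable types\<close>

text \<open>Bijectivity, and not merely injectivity, lets a search over numbers be a search over
  objects: each number found is the code of a witness, and each number given is the code of an
  argument.\<close>

class encodable =
  fixes enc :: "'a \<Rightarrow> nat"
  assumes bij_enc: "bij enc"

instantiation nat :: encodable
begin
definition "enc (n :: nat) = n"
instance by standard (simp add: enc_nat_def[abs_def] bij_id[unfolded id_def])
end

instantiation prod :: (encodable, encodable) encodable
begin
definition "enc p = prod_encode (enc (fst p), enc (snd p))"
instance
proof
  have "enc = prod_encode \<circ> map_prod (enc :: 'a \<Rightarrow> nat) (enc :: 'b \<Rightarrow> nat)"
    by (auto simp: enc_prod_def fun_eq_iff)
  moreover have "bij (map_prod (enc :: 'a \<Rightarrow> nat) (enc :: 'b \<Rightarrow> nat))"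
    using bij_enc[where 'a='a] bij_enc[where 'a='b]
    by (simp add: bij_def prod.inj_map map_prod_surj)
  ultimately show "bij (enc :: 'a \<times> 'b \<Rightarrow> nat)"
    by (metis bij_comp bij_prod_encode)
qed
end

instantiation list :: (encodable) encodable
begin
definition "enc xs = list_encode (map enc xs)"
instance
proof
  have "enc = list_encode \<circ> map (enc :: 'a \<Rightarrow> nat)"
    by (auto simp: enc_list_def)
  moreover have "bij (map (enc :: 'a \<Rightarrow> nat))"
    using bij_enc[where 'a='a] unfolding bij_def
    by (metis inj_mapI lists_UNIV lists_image)
  ultimately show "bij (enc :: 'a list \<Rightarrow> nat)"
    by (metis bij_comp bij_list_encode)
qed
end

lemma enc_eq_iff: "enc x = enc y \<longleftrightarrow> x = y"
  using bij_enc by (metis bij_def injD)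

lemma enc_surj: "\<exists>x. enc x = n"
  using bij_enc by (metis bij_def surjD)

lemma enc_Nil: "enc [] = 0"
  by (simp add: enc_list_def)

lemma enc_Cons: "enc (x # xs) = Suc (prod_encode (enc x, enc xs))"
  by (simp add: enc_list_def)

text \<open>
  A function of several variables is treated as a function of one environment \<open>x\<close>; binders in
  higher-order arguments extend the environment to a pair.
\<close>

definition cmp :: "('a::encodable \<Rightarrow> 'b::encodable) \<Rightarrow> bool" where
  "cmp f \<longleftrightarrow> (\<exists>A. grec1 A \<and> (\<forall>x. A (enc x) = enc (f x)))"

definition dcd :: "('a::encodable \<Rightarrow> bool) \<Rightarrow> bool" where
  "dcd P \<longleftrightarrow> cmp (\<lambda>x. of_bool (P x) :: nat)"

named_theorems cmp_intros

lemma cmpI: "grec1 A \<Longrightarrow> (\<And>x. enc (f x) = A (enc x)) \<Longrightarrow> cmp f"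
  unfolding cmp_def by auto

lemma cmp_const [cmp_intros]: "cmp (\<lambda>x. c)"
  by (rule cmpI[of "\<lambda>_. enc c"]) (auto intro: grec_const)

lemma cmp_id [cmp_intros]: "cmp (\<lambda>x. x)"
  by (rule cmpI[of "\<lambda>n. n"]) (auto intro: grec_proj)

lemma cmp_comp: "cmp g \<Longrightarrow> cmp f \<Longrightarrow> cmp (\<lambda>x. g (f x))"
proof -
  assume "cmp g" "cmp f"
  then obtain A B where A: "grec1 A" "\<And>x. A (enc x) = enc (g x)"
    and B: "grec1 B" "\<And>x. B (enc x) = enc (f x)"
    unfolding cmp_def by auto
  from grec_comp1[OF A(1) B(1)] show ?thesis
    by (rule cmpI[of "\<lambda>n. A (B n)"]) (simp add: A B)
qed

lemma dcd_comp: "dcd P \<Longrightarrow> cmp f \<Longrightarrow> dcd (\<lambda>x. P (f x))"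
  unfolding dcd_def by (rule cmp_comp)

lemma cmp_Pair [cmp_intros]: "cmp f \<Longrightarrow> cmp g \<Longrightarrow> cmp (\<lambda>x. (f x, g x))"
proof -
  assume "cmp g" "cmp f"
  then obtain A B where "grec1 A" "\<And>x. A (enc x) = enc (f x)" "grec1 B" "\<And>x. B (enc x) = enc (g x)"
    unfolding cmp_def by auto
  then show ?thesis
    by (intro cmpI[of "\<lambda>n. prod_encode (A n, B n)"] grec_comp2[OF grec_prod_encode])
      (auto simp: enc_prod_def)
qed

lemma cmp_fst [cmp_intros]: "cmp f \<Longrightarrow> cmp (\<lambda>x. fst (f x))"
  by (rule cmp_comp[of fst], rule cmpI[OF grec_prod_decode(1)]) (auto simp: enc_prod_def)

lemma cmp_snd [cmp_intros]: "cmp f \<Longrightarrow> cmp (\<lambda>x. snd (f x))"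
  by (rule cmp_comp[of snd], rule cmpI[OF grec_prod_decode(2)]) (auto simp: enc_prod_def)

lemma cmp_binary:
  fixes B :: "nat \<Rightarrow> nat \<Rightarrow> nat"
  shows "grec2 B \<Longrightarrow> cmp f \<Longrightarrow> cmp g \<Longrightarrow> cmp (\<lambda>x. B (f x) (g x))"
proof -
  assume B: "grec2 B" and "cmp g" "cmp f"
  have "cmp (\<lambda>p. B (fst p) (snd p))"
    by (rule cmpI[of "\<lambda>n. B (fst (prod_decode n)) (snd (prod_decode n))"],
        intro grec_comp2[OF B] grec_prod_decode) (auto simp: enc_prod_def enc_nat_def)
  from cmp_comp[OF this cmp_Pair[OF \<open>cmp f\<close> \<open>cmp g\<close>]] show ?thesis
    by simp
qed

lemma cmp_Suc [cmp_intros]: "cmp f \<Longrightarrow> cmp (\<lambda>x. Suc (f x))"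
  by (rule cmp_comp[of Suc], rule cmpI[OF grec_Suc]) (auto simp: enc_nat_def)

lemmas cmp_add [cmp_intros] = cmp_binary[OF grec_add]
lemmas cmp_diff [cmp_intros] = cmp_binary[OF grec_diff]

lemma cmp_enc [cmp_intros]: "cmp f \<Longrightarrow> cmp (\<lambda>x. enc (f x))"
  by (rule cmp_comp[of enc], rule cmpI[OF grec_proj[of 0]]) (auto simp: enc_nat_def)

lemma cmp_list_decode [cmp_intros]: "cmp f \<Longrightarrow> cmp (\<lambda>x. list_decode (f x))"
  by (rule cmp_comp[of list_decode], rule cmpI[OF grec_proj[of 0]])
    (auto simp: enc_list_def enc_nat_def[abs_def])

lemma cmp_rec_nat [cmp_intros]:
  assumes n: "cmp n" and z: "cmp z" and s: "cmp (\<lambda>p. s (fst p) (fst (snd p)) (snd (snd p)))"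
  shows "cmp (\<lambda>x. rec_nat (z x) (s x) (n x))"
proof -
  obtain Z S where ZS: "grec1 Z" "\<And>x. Z (enc x) = enc (z x)"
    "grec1 S" "\<And>x k r. S (enc (x, k, r)) = enc (s x k r)"
    using z s unfolding cmp_def by fastforce
  define R where "R = (\<lambda>n x. rec_nat (Z x) (\<lambda>k r. S (prod_encode (x, prod_encode (k, r)))) n)"
  have R: "grec2 R"
    unfolding R_def
    by (intro grec2_rec ZS grec_comp1[OF ZS(3)] grec_comp2[OF grec_prod_encode] grec_proj) auto
  have "R k (enc x) = enc (rec_nat (z x) (s x) k)" for k x
    by (induction k) (auto simp: R_def ZS(2) enc_prod_def enc_nat_def simp flip: ZS(4))
  then have "cmp (\<lambda>p. rec_nat (z (snd p)) (s (snd p)) (fst p))"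
    by (intro cmpI[of "\<lambda>n. R (fst (prod_decode n)) (snd (prod_decode n))"] grec_comp2[OF R]
        grec_prod_decode) (auto simp: enc_prod_def enc_nat_def)
  from cmp_comp[OF this cmp_Pair[OF n cmp_id]] show ?thesis
    by simp
qed

lemma cmp_If [cmp_intros]:
  assumes "dcd P" "cmp f" "cmp g"
  shows "cmp (\<lambda>x. if P x then f x else g x)"
proof -
  \<comment> \<open>Recursion on a truth value runs its step once or not at all.\<close>
  have "(if P x then f x else g x) = rec_nat (g x) (\<lambda>_ _. f x) (of_bool (P x))" for x
    by (cases "P x") simp_all
  moreover have "cmp (\<lambda>x. rec_nat (g x) (\<lambda>_ _. f x) (of_bool (P x)))"
    using assms unfolding dcd_def by (intro cmp_intros cmp_comp[OF assms(2)])
  ultimately show ?thesis by simp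
qed

lemma dcd_eq_nat:
  fixes f g :: "'a::encodable \<Rightarrow> nat"
  assumes "cmp f" "cmp g"
  shows "dcd (\<lambda>x. f x = g x)"
proof -
  have "of_bool (f x = g x) = 1 - ((f x - g x) + (g x - f x))" for x
    by auto
  then show ?thesis
    unfolding dcd_def using assms by (auto intro!: cmp_intros)
qed

lemma dcd_eq [cmp_intros]: "cmp f \<Longrightarrow> cmp g \<Longrightarrow> dcd (\<lambda>x. f x = g x)"
  using dcd_eq_nat[of "\<lambda>x. enc (f x)" "\<lambda>x. enc (g x)"] by (simp add: cmp_enc enc_eq_iff)

lemma dcd_le [cmp_intros]:
  fixes f g :: "'a::encodable \<Rightarrow> nat"
  shows "cmp f \<Longrightarrow> cmp g \<Longrightarrow> dcd (\<lambda>x. f x \<le> g x)"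
  using dcd_eq[of "\<lambda>x. f x - g x" "\<lambda>x. 0"] by (simp add: cmp_diff cmp_const)

lemma dcd_not [cmp_intros]: "dcd P \<Longrightarrow> dcd (\<lambda>x. \<not> P x)"
proof -
  assume "dcd P"
  then have "cmp (\<lambda>x. if P x then 0 else 1 :: nat)"
    by (intro cmp_intros)
  moreover have "(if P x then 0 else 1) = (of_bool (\<not> P x) :: nat)" for x
    by simp
  ultimately show ?thesis
    unfolding dcd_def by simp
qed

lemma dcd_const: "dcd (\<lambda>x. b)"
  unfolding dcd_def by (rule cmp_const)

lemma dcd_if: "dcd P \<Longrightarrow> dcd Q \<Longrightarrow> dcd R \<Longrightarrow> dcd (\<lambda>x. if P x then Q x else R x)"
proof -
  assume "dcd P" "dcd Q" "dcd R"
  then have "cmp (\<lambda>x. if P x then of_bool (Q x) else of_bool (R x) :: nat)"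
    unfolding dcd_def[of Q] dcd_def[of R] by (intro cmp_intros)
  moreover have "of_bool (if P x then Q x else R x) = (if P x then of_bool (Q x) else of_bool (R x) :: nat)" for x
    by simp
  ultimately show ?thesis
    unfolding dcd_def by simp
qed

lemma dcd_conj [cmp_intros]: "dcd P \<Longrightarrow> dcd Q \<Longrightarrow> dcd (\<lambda>x. P x \<and> Q x)"
proof -
  assume "dcd P" "dcd Q"
  then have "dcd (\<lambda>x. if P x then Q x else False)"
    by (intro dcd_if dcd_const)
  moreover have "(if P x then Q x else False) \<longleftrightarrow> P x \<and> Q x" for x
    by simp
  ultimately show ?thesis by simp
qed

lemma dcd_disj [cmp_intros]: "dcd P \<Longrightarrow> dcd Q \<Longrightarrow> dcd (\<lambda>x. P x \<or> Q x)"
  using dcd_not[OF dcd_conj[OF dcd_not[of P] dcd_not[of Q]]] by simp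

section \<open>Computations with lists\<close>

lemma cmp_Cons [cmp_intros]: "cmp f \<Longrightarrow> cmp g \<Longrightarrow> cmp (\<lambda>x. f x # g x)"
proof -
  assume "cmp g" "cmp f"
  then have *: "cmp (\<lambda>x. Suc (enc (f x, g x)))"
    by (intro cmp_intros)
  then obtain A where A: "grec1 A" "\<And>x. A (enc x) = enc (Suc (enc (f x, g x)))"
    unfolding cmp_def by auto
  then show ?thesis
    by (intro cmpI[OF A(1)]) (simp add: enc_Cons enc_prod_def enc_nat_def)
qed

lemma cmp_tl [cmp_intros]: "cmp f \<Longrightarrow> cmp (\<lambda>x. tl (f x))"
proof (rule cmp_comp[of tl])
  have "grec1 (\<lambda>n. snd (prod_decode (n - 1)))"
    by (intro grec_comp1[OF grec_prod_decode(2)] grec_pred)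
  moreover have "enc (tl xs) = snd (prod_decode (enc xs - 1))" for xs :: "'b list"
  proof (cases xs)
    case Nil
    \<comment> \<open>The empty list has code 0, which the truncated predecessor and the second
      projection both preserve, so the formula covers this case.\<close>
    have "prod_decode 0 = (0, 0)"
      using prod_encode_inverse[of "(0, 0)"] by (simp add: prod_encode_def)
    with Nil show ?thesis by (simp add: enc_Nil)
  qed (simp add: enc_Cons)
  ultimately show "cmp (tl :: 'b list \<Rightarrow> 'b list)"
    by (rule cmpI)
qed

lemma cmp_hd [cmp_intros]: "cmp f \<Longrightarrow> cmp (\<lambda>x. hd (f x))"
proof (rule cmp_comp[of hd])
  \<comment> \<open>\<open>hd []\<close> is unspecified but fixed, so its code is a
    constant.\<close>
  define A where "A n = (if n = 0 then enc (hd [] :: 'b) else fst (prod_decode (n - 1)))" for n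
  have fst: "cmp (\<lambda>n::nat. fst (prod_decode n))"
    by (rule cmpI[OF grec_prod_decode(1)]) (simp add: enc_nat_def)
  have "cmp A"
    unfolding A_def by (intro cmp_intros cmp_comp[OF fst])
  then have "grec1 A"
    unfolding cmp_def by (auto simp: enc_nat_def)
  moreover have "enc (hd xs) = A (enc xs)" for xs :: "'b list"
    by (cases xs) (auto simp: enc_Cons enc_Nil A_def)
  ultimately show "cmp (hd :: 'b list \<Rightarrow> 'b)"
    by (rule cmpI)
qed

text \<open>Folds are run as recursions with a prescribed number of rounds. The code of a list
  supplies enough rounds before its length is known to be computable.\<close>

lemma length_le_enc: "length xs \<le> enc xs"
proof (induction xs)
  case (Cons x xs)
  have "enc xs \<le> prod_encode (enc x, enc xs)" by (rule le_prod_encode_2)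
  with Cons show ?case by (simp add: enc_Cons)
qed simp

lemma cmp_foldl [cmp_intros]:
  fixes s :: "'a::encodable \<Rightarrow> 'c::encodable \<Rightarrow> 'b::encodable \<Rightarrow> 'c"
  assumes xs: "cmp xs" and z: "cmp z" and s: "cmp (\<lambda>p. s (fst p) (fst (snd p)) (snd (snd p)))"
  shows "cmp (\<lambda>x. foldl (s x) (z x) (xs x))"
proof -
  \<comment> \<open>The state is the accumulator with the remaining list; once that list is empty,
    surplus rounds change nothing.\<close>
  define t where
    "t x k r = (if snd r = [] then r else (s x (fst r) (hd (snd r)), tl (snd r)))" for x r and k :: nat
  have t: "fst (rec_nat (a, ys) (t x) n) = foldl (s x) a ys" if "length ys \<le> n" for a ys x n
    using that
  proof (induction n arbitrary: a ys)
    case (Suc n)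
    \<comment> \<open>\<open>rec_nat\<close> adds a round at the end, whereas a left fold consumes
      the list from the front. Since \<open>t\<close> ignores the round number, the extra round can
      be moved to the start.\<close>
    have shift: "rec_nat r (t x) (Suc n) = rec_nat (t x 0 r) (t x) n" for r n
      by (induction n) (auto simp: t_def)
    have nil: "rec_nat (a, []) (t x) n = (a, [])" for a n
      by (induction n) (auto simp: t_def)
    show ?case
    proof (cases ys)
      case Nil
      then show ?thesis by (simp only: Nil nil) simp
    next
      case (Cons y ys')
      moreover have "t x 0 (a, y # ys') = (s x a y, ys')"
        by (simp add: t_def)
      ultimately show ?thesis
        using Suc.prems Suc.IH[of ys' "s x a y"] unfolding shift by simp
    qed
  qed simp
  have "cmp (\<lambda>p::'a \<times> nat \<times> 'c \<times> 'b list. (fst p, fst (snd (snd p)), hd (snd (snd (snd p)))))"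
    by (intro cmp_intros)
  from cmp_comp[OF s this]
  have "cmp (\<lambda>p::'a \<times> nat \<times> 'c \<times> 'b list.
      s (fst p) (fst (snd (snd p))) (hd (snd (snd (snd p)))))"
    by simp
  then have "cmp (\<lambda>x. fst (rec_nat (z x, xs x) (t x) (enc (xs x))))"
    unfolding t_def using xs z by (intro cmp_intros)
  then show ?thesis
    by (simp add: t length_le_enc)
qed

lemma cmp_rev [cmp_intros]: "cmp xs \<Longrightarrow> cmp (\<lambda>x. rev (xs x))"
proof -
  have "foldl (\<lambda>acc e. e # acc) zs ys = rev ys @ zs" for ys zs :: "'b list"
    by (induction ys arbitrary: zs) auto
  then have eq: "rev ys = foldl (\<lambda>acc e. e # acc) [] ys" for ys :: "'b list"
    by simp
  assume "cmp xs"
  then show ?thesis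
    unfolding eq by (intro cmp_intros)
qed

lemma cmp_foldr [cmp_intros]:
  fixes s :: "'a::encodable \<Rightarrow> 'b::encodable \<Rightarrow> 'c::encodable \<Rightarrow> 'c"
  assumes xs: "cmp xs" and z: "cmp z" and s: "cmp (\<lambda>p. s (fst p) (fst (snd p)) (snd (snd p)))"
  shows "cmp (\<lambda>x. foldr (s x) (xs x) (z x))"
proof -
  have "cmp (\<lambda>p::'a \<times> 'c \<times> 'b. (fst p, snd (snd p), fst (snd p)))"
    by (intro cmp_intros)
  from cmp_comp[OF s this]
  have "cmp (\<lambda>p. s (fst p) (snd (snd p)) (fst (snd p)))"
    by simp
  then show ?thesis
    unfolding foldr_conv_foldl using xs z by (intro cmp_intros)
qed

lemma cmp_append [cmp_intros]: "cmp f \<Longrightarrow> cmp g \<Longrightarrow> cmp (\<lambda>x. f x @ g x)"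
proof -
  have eq: "ys @ zs = foldr Cons ys zs" for ys zs :: "'b list"
    by (induction ys) auto
  assume "cmp f" "cmp g"
  then show ?thesis
    unfolding eq by (intro cmp_intros)
qed

lemma cmp_map [cmp_intros]:
  fixes f :: "'a::encodable \<Rightarrow> 'b::encodable \<Rightarrow> 'c::encodable"
  assumes "cmp xs" "cmp (\<lambda>p. f (fst p) (snd p))"
  shows "cmp (\<lambda>x. map (f x) (xs x))"
proof -
  have eq: "map g ys = foldr (\<lambda>y acc. g y # acc) ys []" for g :: "'b \<Rightarrow> 'c" and ys
    by (induction ys) auto
  have "cmp (\<lambda>p::'a \<times> 'b \<times> 'c list. (fst p, fst (snd p)))"
    by (intro cmp_intros)
  from cmp_comp[OF assms(2) this]
  have "cmp (\<lambda>p::'a \<times> 'b \<times> 'c list. f (fst p) (fst (snd p)))"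
    by simp
  then show ?thesis
    unfolding eq using assms(1) by (intro cmp_intros)
qed

lemma cmp_concat [cmp_intros]: "cmp xs \<Longrightarrow> cmp (\<lambda>x. concat (xs x))"
  unfolding concat_conv_foldr by (intro cmp_intros)

lemma cmp_sum_list [cmp_intros]:
  fixes xs :: "'a::encodable \<Rightarrow> nat list"
  shows "cmp xs \<Longrightarrow> cmp (\<lambda>x. sum_list (xs x))"
  unfolding sum_list.eq_foldr by (intro cmp_intros)

lemma cmp_filter [cmp_intros]:
  assumes "cmp xs" "dcd (\<lambda>p. P (fst p) (snd p))"
  shows "cmp (\<lambda>x. filter (P x) (xs x))"
proof -
  have eq: "filter Q ys = concat (map (\<lambda>y. if Q y then [y] else []) ys)" for Q and ys :: "'b list"
    by (induction ys) auto
  show ?thesis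
    unfolding eq using assms by (intro cmp_intros)
qed

lemma dcd_Ball [cmp_intros]:
  assumes "cmp xs" "dcd (\<lambda>p. P (fst p) (snd p))"
  shows "dcd (\<lambda>x. \<forall>y\<in>set (xs x). P x y)"
proof -
  have eq: "(\<forall>y\<in>set ys. Q y) \<longleftrightarrow> filter (\<lambda>y. \<not> Q y) ys = []" for Q and ys :: "'b list"
    by (simp add: filter_empty_conv)
  show ?thesis
    unfolding eq using assms by (intro cmp_intros)
qed

lemma dcd_Bex [cmp_intros]:
  assumes "cmp xs" "dcd (\<lambda>p. P (fst p) (snd p))"
  shows "dcd (\<lambda>x. \<exists>y\<in>set (xs x). P x y)"
  using dcd_not[OF dcd_Ball[OF assms(1) dcd_not[OF assms(2)]]] by simp

lemma dcd_mem [cmp_intros]: "cmp f \<Longrightarrow> cmp xs \<Longrightarrow> dcd (\<lambda>x. f x \<in> set (xs x))"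
proof -
  have eq: "y \<in> set ys \<longleftrightarrow> (\<exists>z\<in>set ys. y = z)" for y :: 'b and ys
    by simp
  assume "cmp f" "cmp xs"
  then show ?thesis
    unfolding eq by (intro cmp_intros cmp_comp[OF \<open>cmp f\<close>])
qed

lemma cmp_length [cmp_intros]: "cmp xs \<Longrightarrow> cmp (\<lambda>x. length (xs x))"
proof -
  have eq: "length ys = foldr (\<lambda>_. Suc) ys 0" for ys :: "'b list"
    by (induction ys) auto
  assume "cmp xs"
  then show ?thesis
    unfolding eq by (intro cmp_intros)
qed

lemma cmp_replicate [cmp_intros]: "cmp n \<Longrightarrow> cmp f \<Longrightarrow> cmp (\<lambda>x. replicate (n x) (f x))"
proof -
  have eq: "replicate k y = rec_nat [] (\<lambda>_ r. y # r) k" for k and y :: 'b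
    by (induction k) auto
  assume "cmp n" "cmp f"
  then show ?thesis
    unfolding eq by (intro cmp_intros cmp_comp[OF \<open>cmp f\<close>])
qed

lemma cmp_drop [cmp_intros]: "cmp n \<Longrightarrow> cmp xs \<Longrightarrow> cmp (\<lambda>x. drop (n x) (xs x))"
proof -
  have eq: "drop k ys = rec_nat ys (\<lambda>_ r. tl r) k" for k and ys :: "'b list"
    by (induction k) (simp_all add: drop_Suc flip: tl_drop)
  assume "cmp n" "cmp xs"
  then show ?thesis
    unfolding eq by (intro cmp_intros)
qed

text \<open>The witness chosen is the one with the least code. Minimization demands a zero for every
  numerical parameter; this follows from \<open>ex\<close> because every number is the code of some
  argument.\<close>

lemma cmp_search:
  fixes P :: "'a::encodable \<Rightarrow> 'b::encodable \<Rightarrow> bool"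
  assumes P: "dcd (\<lambda>p. P (fst p) (snd p))" and ex: "\<And>x. \<exists>y. P x y"
  shows "\<exists>f. cmp f \<and> (\<forall>x. P x (f x))"
proof -
  have "dcd (\<lambda>p. P (snd p) (fst p))"
    using P unfolding dcd_def using cmp_comp[of _ "\<lambda>p. (snd p, fst p)"]
    by (fastforce intro: cmp_intros)
  then have "cmp (\<lambda>p. of_bool (\<not> P (snd p) (fst p)) :: nat)"
    unfolding dcd_def[symmetric] by (rule dcd_not)
  then obtain A where A: "grec1 A" "\<And>x y. A (prod_encode (enc y, enc x)) = of_bool (\<not> P x y)"
    unfolding cmp_def by (fastforce simp: enc_prod_def enc_nat_def)
  define B where "B y x = A (prod_encode (y, x))" for y x
  have B: "B (enc y) (enc x) = 0 \<longleftrightarrow> P x y" for x y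
    by (simp add: B_def A)
  have B': "\<exists>y. B y x = 0" for x
    using B ex enc_surj[where 'a='a, of x] by metis
  have "grec2 B"
    unfolding B_def by (intro grec_comp1[OF A(1)] grec_prod_encode)
  then have L: "grec1 (\<lambda>x. LEAST y. B y x = 0)"
    using B' by (rule grec_least)
  define f :: "'a \<Rightarrow> 'b" where "f x = inv enc (LEAST y. B y (enc x) = 0)" for x
  have f: "enc (f x) = (LEAST y. B y (enc x) = 0)" for x
    unfolding f_def using bij_enc[where 'a='b] by (simp add: bij_def surj_f_inv_f)
  have "P x (f x)" for x
    using LeastI_ex[OF B'[of "enc x"]] unfolding f[symmetric] B .
  moreover have "cmp f"
    by (rule cmpI[OF L]) (rule f)
  ultimately show ?thesis by blast
qed


section \<open>Certificates\<close>

type_synonym 'v wterm = "('v \<times> nat \<times> nat) \<times> nat \<times> nat"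
type_synonym 'v wgraph = "'v \<Rightarrow> (nat \<times> nat \<times> 'v) list"
type_synonym cpoly = "(nat \<times> nat) list list"

text \<open>
  The pair \<open>(u, w)\<close> of natural numbers stands for the integer \<open>u - w\<close>, and
  \<open>((v, a, b), c)\<close> for the term \<open>c X\<^sup>a Q\<^sup>b\<close> at the vertex \<open>v\<close>. An edge \<open>(l, s, v')\<close> has weight
  \<open>X\<^sup>l Q\<^sup>s\<close>.
\<close>

definition coef :: "nat \<times> nat \<Rightarrow> int" where
  "coef c = int (fst c) - int (snd c)"

definition eval :: "'r::comm_ring_1 \<Rightarrow> 'r \<Rightarrow> ('v \<Rightarrow> 'r) \<Rightarrow> 'v wterm list \<Rightarrow> 'r" where
  "eval X Q g T = (\<Sum>((v, a, b), c)\<leftarrow>T. of_int (coef c) * (X ^ a * Q ^ b * g v))"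

text \<open>The exponent \<open>s + d * l\<close> comes from substituting x q^d for x in the weight
  x^l q^s.\<close>

definition extend_terms :: "'v wgraph \<Rightarrow> nat \<Rightarrow> 'v wterm list \<Rightarrow> 'v wterm list" where
  "extend_terms E d T =
     concat (map (\<lambda>((v, a, b), c). map (\<lambda>(l, s, v'). ((v', a + l, b + (s + d * l)), c)) (E v)) T)"

definition advance :: "'r::comm_ring_1 \<Rightarrow> 'r \<Rightarrow> 'v wgraph \<Rightarrow> nat \<Rightarrow> ('v \<Rightarrow> 'r) \<Rightarrow> 'v \<Rightarrow> 'r" where
  "advance X Q E d g v = (\<Sum>(l, s, v')\<leftarrow>E v. X ^ l * Q ^ (s + d * l) * g v')"

definition row_terms :: "(nat \<times> nat) list \<Rightarrow> (nat \<times> nat \<times> nat) list" where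
  "row_terms row = foldr (\<lambda>c acc. (0, c) # map (\<lambda>(b, c). (Suc b, c)) acc) row []"

definition start_terms :: "'v \<Rightarrow> cpoly \<Rightarrow> 'v wterm list" where
  "start_terms v p = foldr (\<lambda>row acc. map (\<lambda>(b, c). ((v, 0, b), c)) (row_terms row) @
     map (\<lambda>((v, a, b), c). ((v, Suc a, b), c)) acc) p []"

text \<open>After j polynomials the offset is \<open>d = j * m\<close>, and \<open>T\<close>
  collects their contributions in terms of the values at that shift. The next polynomial joins at
  \<open>v\<close>, and everything moves on together to the next shift, so a single list serves all
  of them.\<close>

definition run_terms :: "'v wgraph \<Rightarrow> nat \<Rightarrow> 'v \<Rightarrow> cpoly list \<Rightarrow> nat \<times> 'v wterm list" where
  "run_terms E m v = foldl (\<lambda>(d, T) p. (d + m, extend_terms E d (T @ start_terms v p))) (0, [])"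

definition row_val :: "'r::comm_ring_1 \<Rightarrow> (nat \<times> nat) list \<Rightarrow> 'r" where
  "row_val Q row = foldr (\<lambda>c acc. of_int (coef c) + Q * acc) row 0"

definition poly_val :: "'r::comm_ring_1 \<Rightarrow> 'r \<Rightarrow> cpoly \<Rightarrow> 'r" where
  "poly_val X Q p = foldr (\<lambda>row acc. row_val Q row + X * acc) p 0"

text \<open>With the negative parts moved to the other side, the vanishing of a collected
  coefficient is decided by adding natural numbers. Checking the keys that occur makes the test
  finite.\<close>

definition zero_terms :: "'v wterm list \<Rightarrow> bool" where
  "zero_terms T \<longleftrightarrow> (\<forall>t\<in>set T.
     sum_list (map (\<lambda>t. fst (snd t)) (filter (\<lambda>t'. fst t' = fst t) T)) =
     sum_list (map (\<lambda>t. snd (snd t)) (filter (\<lambda>t'. fst t' = fst t) T)))"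

text \<open>Without trailing zeros in either variable, a nonempty list stands for a nonzero
  polynomial, and its entries are exactly the \<open>coeffs\<close>. Nontriviality becomes a
  syntactic test, and the output can be written down entry by entry.\<close>

definition normal_cpoly :: "cpoly \<Rightarrow> bool" where
  "normal_cpoly p \<longleftrightarrow> (p = [] \<or> last p \<noteq> []) \<and>
     (\<forall>row\<in>set p. row = [] \<or> fst (last row) \<noteq> snd (last row))"

definition certificate :: "'v wgraph \<Rightarrow> nat \<Rightarrow> 'v \<Rightarrow> cpoly list \<Rightarrow> bool" where
  "certificate E m v ps \<longleftrightarrow> (\<exists>p\<in>set ps. p \<noteq> []) \<and> (\<forall>p\<in>set ps. normal_cpoly p) \<and>
     zero_terms (snd (run_terms E m v ps))"

section \<open>Evaluation of formal terms\<close>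

lemma eval_append: "eval X Q g (S @ T) = eval X Q g S + eval X Q g T"
  by (simp add: eval_def)

text \<open>Extending the terms is the transpose of advancing the values: both run along the same
  edges.\<close>

lemma eval_extend_terms: "eval X Q g (extend_terms E d T) = eval X Q (advance X Q E d g) T"
proof (induction T)
  case (Cons t T)
  obtain v a b c where t: "t = ((v, a, b), c)"
    by (metis prod.exhaust)
  have "eval X Q g (map (\<lambda>(l, s, v'). ((v', a + l, b + (s + d * l)), c)) es) =
      of_int (coef c) * (X ^ a * Q ^ b * (\<Sum>(l, s, v')\<leftarrow>es. X ^ l * Q ^ (s + d * l) * g v'))" for es
    by (induction es) (auto simp: eval_def power_add algebra_simps)
  then have "eval X Q g (extend_terms E d [t]) = eval X Q (advance X Q E d g) [t]"
    by (simp add: t extend_terms_def advance_def eval_def)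
  moreover have "extend_terms E d (t # T) = extend_terms E d [t] @ extend_terms E d T"
    by (simp add: extend_terms_def)
  moreover have "eval X Q h (t # T) = eval X Q h [t] + eval X Q h T" for h
    by (simp add: eval_def)
  ultimately show ?case
    using Cons by (simp only: eval_append)
qed (simp add: eval_def extend_terms_def)

lemma eval_start: "eval X Q g (start_terms v p) = poly_val X Q p * g v"
proof -
  have row: "eval X Q g (map (\<lambda>(b, c). ((v, 0, b), c)) (row_terms row)) = row_val Q row * g v" for row
  proof (induction row)
    case (Cons c row)
    have "eval X Q g (map (\<lambda>(b, c). ((v, 0, b), c)) (map (\<lambda>(b, c). (Suc b, c)) bs)) =
        Q * eval X Q g (map (\<lambda>(b, c). ((v, 0, b), c)) bs)" for bs
      by (induction bs) (auto simp: eval_def algebra_simps)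
    with Cons show ?case
      by (simp add: row_terms_def row_val_def eval_def algebra_simps)
  qed (simp add: row_terms_def row_val_def eval_def)
  have shift: "eval X Q g (map (\<lambda>((v, a, b), c). ((v, Suc a, b), c)) T) = X * eval X Q g T" for T
    by (induction T) (auto simp: eval_def algebra_simps)
  show ?thesis
  proof (induction p)
    case (Cons r p)
    then show ?case
      by (simp add: start_terms_def poly_val_def eval_append row shift algebra_simps)
  qed (simp add: start_terms_def poly_val_def eval_def)
qed

lemma run_terms_snoc:
  "run_terms E m v (ps @ [p]) =
     (let (d, T) = run_terms E m v ps in (d + m, extend_terms E d (T @ start_terms v p)))"
  by (simp add: run_terms_def split_def Let_def)

lemma fst_run_terms: "fst (run_terms E m v ps) = length ps * m"
proof (induction ps rule: rev_induct)
  case (snoc p ps)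
  then show ?case by (simp add: run_terms_snoc split_def algebra_simps)
qed (simp add: run_terms_def)

text \<open>Serves two families \<open>g\<close>: the shifted generating functions, for soundness,
  and polynomials pulled back from indicator functions, for existence.\<close>

lemma eval_run_terms:
  assumes "\<And>j. j < length ps \<Longrightarrow> g j = advance X Q E (j * m) (g (Suc j))"
  shows "eval X Q (g (length ps)) (snd (run_terms E m v ps)) =
    (\<Sum>j<length ps. poly_val X Q (ps ! j) * g j v)"
  using assms
proof (induction ps rule: rev_induct)
  case (snoc p ps)
  have "eval X Q (g (length (ps @ [p]))) (snd (run_terms E m v (ps @ [p]))) =
      eval X Q (g (length ps)) (snd (run_terms E m v ps) @ start_terms v p)"
    using snoc.prems[of "length ps"]
    by (simp add: run_terms_snoc split_def fst_run_terms eval_extend_terms)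
  also have "\<dots> = (\<Sum>j<length ps. poly_val X Q (ps ! j) * g j v) + poly_val X Q p * g (length ps) v"
    using snoc.IH snoc.prems by (simp add: eval_append eval_start)
  also have "\<dots> = (\<Sum>j<length (ps @ [p]). poly_val X Q ((ps @ [p]) ! j) * g j v)"
    by (simp add: nth_append)
  finally show ?case .
qed (simp add: run_terms_def eval_def)

section \<open>Cancellation of formal terms\<close>

lemma sum_list_group:
  fixes f :: "'c \<Rightarrow> 'r::comm_ring_1"
  assumes "finite S" "fst ` set T \<subseteq> S"
  shows "(\<Sum>t\<leftarrow>T. f (snd t) * h (fst t)) = (\<Sum>k\<in>S. (\<Sum>t\<leftarrow>filter (\<lambda>t. fst t = k) T. f (snd t)) * h k)"
  using assms(2)
proof (induction T)
  case (Cons t T)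
  have "(\<Sum>k\<in>S. (\<Sum>t'\<leftarrow>filter (\<lambda>t'. fst t' = k) (t # T). f (snd t')) * h k) =
      (\<Sum>k\<in>S. (if k = fst t then f (snd t) * h k else 0) +
        (\<Sum>t\<leftarrow>filter (\<lambda>t. fst t = k) T. f (snd t)) * h k)"
    by (intro sum.cong) (auto simp: algebra_simps)
  also have "\<dots> = f (snd t) * h (fst t) + (\<Sum>k\<in>S. (\<Sum>t\<leftarrow>filter (\<lambda>t. fst t = k) T. f (snd t)) * h k)"
    using Cons.prems assms(1) by (simp add: sum.distrib)
  finally show ?case
    using Cons by simp
qed simp

lemma sum_coef:
  "(\<Sum>t\<leftarrow>T. coef (snd t)) =
     int (sum_list (map (\<lambda>t. fst (snd t)) T)) - int (sum_list (map (\<lambda>t. snd (snd t)) T))"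
  by (induction T) (auto simp: coef_def)

lemma of_int_sum_list: "of_int (sum_list xs) = (\<Sum>x\<leftarrow>xs. of_int x)"
  by (induction xs) auto

lemma zero_terms_iff:
  "zero_terms T \<longleftrightarrow> (\<forall>k. (\<Sum>t\<leftarrow>filter (\<lambda>t. fst t = k) T. coef (snd t)) = 0)"
  (is "_ \<longleftrightarrow> (\<forall>k. ?G k = 0)")
proof -
  define G where "G k = ?G k" for k
  have "zero_terms T \<longleftrightarrow> (\<forall>t\<in>set T. ?G (fst t) = 0)"
    unfolding zero_terms_def sum_coef by auto
  moreover have "?G k = 0" if "k \<notin> fst ` set T" for k
  proof -
    have "filter (\<lambda>t. fst t = k) T = []"
      using that by (auto simp: filter_empty_conv)
    then show ?thesis by simp
  qed
  moreover have "(\<forall>t\<in>set T. G (fst t) = 0) \<longleftrightarrow> (\<forall>k\<in>fst ` set T. G k = 0)"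
    by simp
  ultimately have "zero_terms T \<longleftrightarrow> (\<forall>k. G k = 0)"
    unfolding G_def[symmetric] by blast
  then show ?thesis
    unfolding G_def .
qed

lemma eval_zero_terms:
  fixes X Q :: "'r::comm_ring_1"
  assumes "zero_terms T"
  shows "eval X Q g T = 0"
proof -
  define h where "h = (\<lambda>(v, a, b). X ^ a * Q ^ b * g v)"
  have zero: "(\<Sum>t\<leftarrow>filter (\<lambda>t. fst t = k) T. of_int (coef (snd t))) = (0 :: 'r)" for k
    using assms unfolding zero_terms_iff
    by (metis (no_types, lifting) map_map o_def of_int_0 of_int_sum_list map_eq_conv)
  have "eval X Q g T = (\<Sum>t\<leftarrow>T. of_int (coef (snd t)) * h (fst t))"
    by (simp add: eval_def h_def split_def)
  also have "\<dots> = (\<Sum>k\<in>fst ` set T. (\<Sum>t\<leftarrow>filter (\<lambda>t. fst t = k) T. of_int (coef (snd t))) * h k)"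
    by (rule sum_list_group) auto
  finally show ?thesis by (simp add: zero)
qed

abbreviation polyX :: "int poly poly" where "polyX \<equiv> [:0, 1:]"
abbreviation polyQ :: "int poly poly" where "polyQ \<equiv> [:[:0, 1:]:]"

lemma of_int_poly2: "(of_int z :: int poly poly) = [:[:z:]:]"
  by (simp add: of_int_poly)

lemma term_eq_monom: "of_int z * (polyX ^ a * polyQ ^ b) = monom (monom z b) a"
proof -
  have "polyQ ^ b = [:monom 1 b:]"
    by (induction b) (auto simp: monom_altdef one_pCons)
  moreover have "polyX ^ a = monom 1 a"
    by (induction a) (auto simp: monom_altdef one_pCons)
  ultimately show ?thesis
    by (simp add: of_int_poly2 smult_monom ac_simps)
qed

text \<open>Generic arguments give a converse of \<open>eval_zero_terms\<close>: the two variables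
  are independent and the indicator function isolates one vertex, so each collected coefficient can
  be read off as a coefficient of the value.\<close>

lemma zero_terms_if_eval:
  assumes "\<And>v. eval polyX polyQ (\<lambda>v'. of_bool (v' = v)) T = 0"
  shows "zero_terms T"
  unfolding zero_terms_iff
proof
  fix k :: "'a \<times> nat \<times> nat"
  obtain v a b where k: "k = (v, a, b)"
    by (metis prod.exhaust)
  have "coeff (coeff (eval polyX polyQ (\<lambda>v'. of_bool (v' = v)) T) a) b =
      (\<Sum>t\<leftarrow>filter (\<lambda>t. fst t = k) T. coef (snd t))"
  proof (induction T)
    case (Cons t T)
    obtain v' a' b' c where t: "t = ((v', a', b'), c)"
      by (metis prod.exhaust)
    have "eval polyX polyQ (\<lambda>v'. of_bool (v' = v)) (t # T) =
        (if v' = v then monom (monom (coef c) b') a' else 0) +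
        eval polyX polyQ (\<lambda>v'. of_bool (v' = v)) T"
      by (auto simp: t eval_def term_eq_monom[symmetric])
    then show ?case
      using Cons by (auto simp: t k)
  qed (simp add: eval_def)
  then show "(\<Sum>t\<leftarrow>filter (\<lambda>t. fst t = k) T. coef (snd t)) = 0"
    by (simp add: assms)
qed

lemma row_val_poly: "row_val polyQ row = [:Poly (map coef row):]"
  by (induction row) (auto simp: row_val_def of_int_poly2)

lemma poly_val_poly: "poly_val polyX polyQ p = Poly (map (\<lambda>row. Poly (map coef row)) p)"
  by (induction p) (auto simp: poly_val_def row_val_poly)

lemma extend_terms_edge:
  "t \<in> set (extend_terms E d T) \<Longrightarrow> \<exists>t'\<in>set T. \<exists>l s. (l, s, fst (fst t)) \<in> set (E (fst (fst t')))"
proof -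
  assume "t \<in> set (extend_terms E d T)"
  then obtain t' e where "t' \<in> set T" "e \<in> set (E (fst (fst t')))" "fst (fst t) = snd (snd e)"
    unfolding extend_terms_def by (auto simp: split_def)
  then show ?thesis
    by (metis prod.collapse)
qed

text \<open>Confines the linear system to one equation for each vertex in \<open>V\<close>, as no
  terms arise elsewhere.\<close>

lemma run_terms_vertices:
  assumes "v \<in> V" "\<And>v l s v'. v \<in> V \<Longrightarrow> (l, s, v') \<in> set (E v) \<Longrightarrow> v' \<in> V"
  shows "t \<in> set (snd (run_terms E m v ps)) \<Longrightarrow> fst (fst t) \<in> V"
proof (induction ps arbitrary: t rule: rev_induct)
  case (snoc p ps)
  have "fst (fst t) = v" if "t \<in> set (start_terms v p)" for t
    using that by (induction p arbitrary: t) (auto simp: start_terms_def)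
  then have "fst (fst t) \<in> V" if "t \<in> set (snd (run_terms E m v ps) @ start_terms v p)" for t
    using that snoc.IH assms(1) by (metis Un_iff set_append)
  moreover have "t \<in> set (extend_terms E (length ps * m) (snd (run_terms E m v ps) @ start_terms v p))"
    using snoc.prems by (simp add: run_terms_snoc split_def fst_run_terms)
  from extend_terms_edge[OF this] obtain t' l s
    where "t' \<in> set (snd (run_terms E m v ps) @ start_terms v p)"
      "(l, s, fst (fst t)) \<in> set (E (fst (fst t')))"
    by blast
  ultimately show ?case
    using assms(2) by metis
qed (simp add: run_terms_def)

text \<open>Gaussian elimination without division.\<close>

lemma linear_dependence:
  fixes a :: "'e \<Rightarrow> 'j \<Rightarrow> 'r::idom"
  assumes "finite V" "finite J" "card V < card J"
  shows "\<exists>p. (\<exists>j\<in>J. p j \<noteq> 0) \<and> (\<forall>e\<in>V. (\<Sum>j\<in>J. p j * a e j) = 0)"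
  using assms
proof (induction V arbitrary: J a rule: finite_induct)
  case empty
  then have "J \<noteq> {}" by auto
  then show ?case by (intro exI[of _ "\<lambda>_. 1"]) auto
next
  case (insert e V)
  show ?case
  proof (cases "\<forall>j\<in>J. a e j = 0")
    case True
    from insert have "\<exists>p. (\<exists>j\<in>J. p j \<noteq> 0) \<and> (\<forall>e\<in>V. (\<Sum>j\<in>J. p j * a e j) = 0)"
      by (intro insert.IH) auto
    with True show ?thesis by auto
  next
    case False
    then obtain k where k: "k \<in> J" "a e k \<noteq> 0" by auto
    define J' where "J' = J - {k}"
    have J: "J = insert k J'" "k \<notin> J'" "finite J'"
      using k insert.prems by (auto simp: J'_def)
    have "\<exists>p. (\<exists>j\<in>J'. p j \<noteq> 0) \<and>
        (\<forall>f\<in>V. (\<Sum>j\<in>J'. p j * (a e k * a f j - a f k * a e j)) = 0)"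
      using insert.prems insert.hyps J by (intro insert.IH) auto
    then obtain p where p: "\<exists>j\<in>J'. p j \<noteq> 0"
      "\<And>f. f \<in> V \<Longrightarrow> (\<Sum>j\<in>J'. p j * (a e k * a f j - a f k * a e j)) = 0"
      by auto
    \<comment> \<open>Equation \<open>e\<close> is solved for the pivot \<open>k\<close>; scaling
      the other entries by \<open>a e k\<close> avoids dividing by it.\<close>
    define r where "r j = (if j = k then - (\<Sum>j\<in>J'. p j * a e j) else a e k * p j)" for j
    have r: "(\<Sum>j\<in>J. r j * a f j) = - (\<Sum>j\<in>J'. p j * a e j) * a f k + (\<Sum>j\<in>J'. a e k * p j * a f j)" for f
      using J by (auto simp: r_def intro!: sum.cong)
    have "(\<Sum>j\<in>J. r j * a f j) = 0" if "f \<in> insert e V" for f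
    proof (cases "f = e")
      case True
      then show ?thesis
        unfolding r by (simp add: sum_distrib_left sum_distrib_right algebra_simps)
    next
      case False
      with that have "f \<in> V" by simp
      have "(\<Sum>j\<in>J. r j * a f j) = (\<Sum>j\<in>J'. p j * (a e k * a f j - a f k * a e j))"
        unfolding r
        by (simp add: sum_distrib_left sum_distrib_right sum_subtractf[symmetric] sum_negf[symmetric]
            sum.distrib[symmetric] algebra_simps)
      with p(2)[OF \<open>f \<in> V\<close>] show ?thesis by simp
    qed
    moreover have "\<exists>j\<in>J. r j \<noteq> 0"
      using p(1) k J by (auto simp: r_def)
    ultimately show ?thesis by blast
  qed
qed

text \<open>
  The evaluation of the terms at a vertex is linear in the \<open>K\<close> polynomials, so that a
  nontrivial choice vanishes at all vertices as soon as \<open>K\<close> exceeds their number.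
\<close>

lemma certificate_exists:
  assumes V: "finite V" "v \<in> V" "\<And>v l s v'. v \<in> V \<Longrightarrow> (l, s, v') \<in> set (E v) \<Longrightarrow> v' \<in> V"
  shows "\<exists>ps. certificate E m v ps"
proof -
  \<comment> \<open>One polynomial more than there are equations. Below, \<open>G u i\<close> is the
    indicator function of \<open>u\<close> pulled back \<open>i\<close> steps from the end, so that
    \<open>g u j v\<close> is the coefficient of F_u(x q^(K m)) in the expansion of F_v(x q^(j
    m)).\<close>
  define K where "K = Suc (card V)"
  define G where "G u = rec_nat (\<lambda>v'. of_bool (v' = u))
    (\<lambda>i g. advance polyX polyQ E ((K - Suc i) * m) g)" for u
  define g where "g u j = G u (K - j)" for u j
  have g: "g u j = advance polyX polyQ E (j * m) (g u (Suc j))" if "j < K" for u j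
  proof -
    have "K - j = Suc (K - Suc j)" "K - (K - j) = j"
      using that by auto
    then show ?thesis
      by (simp add: g_def G_def)
  qed
  have "\<exists>p. (\<exists>j\<in>{..<K}. p j \<noteq> 0) \<and> (\<forall>u\<in>V. (\<Sum>j<K. p j * g u j v) = 0)"
    using V(1) by (intro linear_dependence) (auto simp: K_def)
  then obtain p where p: "\<exists>j<K. p j \<noteq> 0" "\<And>u. u \<in> V \<Longrightarrow> (\<Sum>j<K. p j * g u j v) = 0"
    by auto
  define row where "row r = map (\<lambda>z. (nat z, nat (- z))) (coeffs r)" for r :: "int poly"
  define ps where "ps = map (\<lambda>j. map row (coeffs (p j))) [0..<K]"
  have row: "map coef (row r) = coeffs r" for r
    by (auto simp: row_def coef_def intro!: map_idI)
  have normal: "normal_cpoly (map row (coeffs r))" for r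
  proof -
    have "nat z \<noteq> nat (- z)" if "z \<noteq> 0" for z
      using that by linarith
    then show ?thesis
      by (auto simp: normal_cpoly_def last_map row_def last_coeffs_eq_coeff_degree)
  qed
  have zero: "eval polyX polyQ (\<lambda>v'. of_bool (v' = u)) (snd (run_terms E m v ps)) = 0" for u
  proof (cases "u \<in> V")
    case True
    have "eval polyX polyQ (g u (length ps)) (snd (run_terms E m v ps)) =
        (\<Sum>j<length ps. poly_val polyX polyQ (ps ! j) * g u j v)"
      by (rule eval_run_terms) (simp add: ps_def g)
    also have "\<dots> = (\<Sum>j<K. p j * g u j v)"
      by (simp add: ps_def poly_val_poly row o_def)
    finally show ?thesis
      using p(2)[OF True] by (simp add: g_def G_def ps_def)
  next
    case False
    have "fst (fst t) \<noteq> u" if "t \<in> set (snd (run_terms E m v ps))" for t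
      using run_terms_vertices[of v V E t, OF V(2,3) that] False by auto
    moreover have "eval polyX polyQ (\<lambda>v'. of_bool (v' = u)) T = 0"
      if "\<And>t. t \<in> set T \<Longrightarrow> fst (fst t) \<noteq> u" for T
      using that by (induction T) (simp_all add: eval_def split_def)
    ultimately show ?thesis by blast
  qed
  have "certificate E m v ps"
    unfolding certificate_def using zero_terms_if_eval[OF zero] p(1) normal
    by (auto simp: ps_def)
  then show ?thesis ..
qed


section \<open>From certificates to $q$-difference equations\<close>

text \<open>A certificate relates shifts by multiples of \<open>m\<close> only, whereas a
  q-difference equation lists every shift. Zero polynomials fill the \<open>m - 1\<close>
  gaps.\<close>

definition spread :: "nat \<Rightarrow> cpoly list \<Rightarrow> cpoly list" where
  "spread m ps = concat (map (\<lambda>p. p # replicate (m - 1) []) ps)"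

definition rat_poly :: "cpoly \<Rightarrow> rat poly poly" where
  "rat_poly p = Poly (map (\<lambda>row. Poly (map (\<lambda>c. of_int (coef c)) row)) p)"

section \<open>Shifts of power series\<close>

lemma nth_q_shift: "fps_nth (q_shift k F) a = fps_X ^ (k * a) * fps_nth F a"
  by (simp add: q_shift_def fps_compose_linear power_mult)

lemma q_shift_q_shift: "q_shift j (q_shift k F) = q_shift (j + k) F"
  by (rule fps_ext) (simp add: nth_q_shift add_mult_distrib power_add mult.assoc)

lemma q_shift_sum_list: "q_shift k (\<Sum>x\<leftarrow>xs. f x) = (\<Sum>x\<leftarrow>xs. q_shift k (f x))"
proof (induction xs)
  case Nil
  show ?case by (rule fps_ext) (simp add: nth_q_shift)
next
  case (Cons x xs)
  have "q_shift k (F + G) = q_shift k F + q_shift k G" for F G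
    by (rule fps_ext) (simp add: nth_q_shift algebra_simps)
  with Cons show ?case by simp
qed

abbreviation fpsQ :: "rat fps fps" where "fpsQ \<equiv> fps_const fps_X"

lemma q_shift_monom:
  "q_shift k (fps_X ^ l * fpsQ ^ s * F) = fps_X ^ l * fpsQ ^ (s + k * l) * q_shift k F"
proof (rule fps_ext)
  fix a
  have "k * a = k * l + k * (a - l)" if "\<not> a < l"
    using that by (simp flip: add_mult_distrib2)
  then show "fps_nth (q_shift k (fps_X ^ l * fpsQ ^ s * F)) a =
      fps_nth (fps_X ^ l * fpsQ ^ (s + k * l) * q_shift k F) a"
    by (simp add: nth_q_shift mult.assoc fps_X_power_mult_nth fps_const_power power_add)
qed

lemma poly_val_rat_poly: "poly_val fps_X fpsQ p = fps_of_poly2 (rat_poly p)"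
proof -
  have row: "row_val fpsQ row = fps_const (fps_of_poly (Poly (map (\<lambda>c. of_int (coef c)) row)))" for row
    by (induction row) (auto simp: row_val_def fps_of_poly_pCons fps_of_int mult.commute
        simp flip: fps_const_add)
  show ?thesis
    by (induction p) (auto simp: poly_val_def rat_poly_def fps_of_poly2_def row map_poly_pCons
        fps_of_poly_pCons mult.commute)
qed

lemma sum_nth_append:
  "(\<Sum>k<length (xs @ ys). f k ((xs @ ys) ! k)) =
     (\<Sum>k<length xs. f k (xs ! k)) + (\<Sum>k<length ys. f (length xs + k) (ys ! k) :: 'r::comm_monoid_add)"
  by (induction ys rule: rev_induct) (simp_all add: nth_append add.assoc flip: append_assoc)

lemma sum_spread:
  assumes "m > 0" "\<And>k. f k [] = 0"
  shows "(\<Sum>k<length (spread m ps). f k (spread m ps ! k)) = (\<Sum>j<length ps. f (j * m) (ps ! j) :: 'r::comm_monoid_add)"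
proof (induction ps rule: rev_induct)
  case (snoc p ps)
  have len: "length (spread m qs) = length qs * m" for qs
    using assms(1) by (induction qs) (auto simp: spread_def)
  have "(\<Sum>k<length (p # replicate (m - 1) []). f (n + k) ((p # replicate (m - 1) []) ! k)) = f n p" for n
  proof -
    have "(\<Sum>k<m - 1. f (n + Suc k) (replicate (m - 1) [] ! k)) = 0"
      by (rule sum.neutral) (simp add: assms(2))
    then show ?thesis
      by (simp add: sum.lessThan_Suc_shift del: sum.lessThan_Suc)
  qed
  moreover have "spread m (ps @ [p]) = spread m ps @ p # replicate (m - 1) []"
    by (simp add: spread_def)
  ultimately show ?case
    by (simp only: sum_nth_append snoc) (simp add: len nth_append)
qed (simp add: spread_def)

lemma rat_poly_nonzero:
  assumes "normal_cpoly p" "p \<noteq> []"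
  shows "rat_poly p \<noteq> 0"
proof
  assume "rat_poly p = 0"
  obtain row where row: "row \<in> set p" "last p = row" "row \<noteq> []"
    using assms by (intro that[of "last p"]) (auto simp: normal_cpoly_def)
  have zero: "x = 0" if "Poly xs = 0" "x \<in> set xs" for xs and x :: "'b::zero"
    using that by (auto simp: Poly_eq_0)
  have "Poly (map (\<lambda>c. of_int (coef c)) row) = (0 :: rat poly)"
    using \<open>rat_poly p = 0\<close> row(1) unfolding rat_poly_def by (auto intro: zero)
  then have "of_int (coef (last row)) = (0 :: rat)"
    by (rule zero) (simp add: row(3))
  with assms row show False
    by (auto simp: normal_cpoly_def coef_def)
qed

text \<open>Shifting the functional equation by \<open>j * m\<close> expresses each shift of
  \<open>G\<close> through the next one, as \<open>eval_run_terms\<close> requires. What is left at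
  the last shift cancels formally, whatever the values of \<open>G\<close> are.\<close>

lemma certificate_sound:
  assumes cert: "certificate E m v ps" and m: "m > 0"
    and G: "\<And>v. G v = (\<Sum>(l, s, v')\<leftarrow>E v. fps_X ^ l * fpsQ ^ s * q_shift m (G v'))"
  shows "q_difference_equation (map rat_poly (spread m ps)) (G v)"
proof -
  define g where "g j v = q_shift (j * m) (G v)" for j v
  have g: "g j = advance fps_X fpsQ E (j * m) (g (Suc j))" for j
  proof
    fix v
    have "g j v = q_shift (j * m) (\<Sum>(l, s, v')\<leftarrow>E v. fps_X ^ l * fpsQ ^ s * q_shift m (G v'))"
      unfolding g_def by (rule arg_cong[OF G])
    also have "\<dots> = advance fps_X fpsQ E (j * m) (g (Suc j)) v"
      unfolding g_def advance_def q_shift_sum_list split_def q_shift_monom q_shift_q_shift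
      by (simp add: add.commute)
    finally show "g j v = advance fps_X fpsQ E (j * m) (g (Suc j)) v" .
  qed
  have "eval fps_X fpsQ (g (length ps)) (snd (run_terms E m v ps)) =
      (\<Sum>j<length ps. fps_of_poly2 (rat_poly (ps ! j)) * q_shift (j * m) (G v))"
    using eval_run_terms[of ps g fps_X fpsQ E m v, OF g] by (simp add: g_def poly_val_rat_poly)
  also have "\<dots> = (\<Sum>k<length (spread m ps). fps_of_poly2 (rat_poly (spread m ps ! k)) * q_shift k (G v))"
    by (rule sum_spread[OF m, symmetric, where f = "\<lambda>k p. fps_of_poly2 (rat_poly p) * q_shift k (G v)"])
      (simp add: rat_poly_def fps_of_poly2_def)
  finally have sum: "(\<Sum>k<length (spread m ps). fps_of_poly2 (rat_poly (spread m ps ! k)) * q_shift k (G v)) = 0"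
    using cert by (simp add: certificate_def eval_zero_terms)
  obtain p where p: "p \<in> set ps" "p \<noteq> []" "normal_cpoly p"
    using cert by (auto simp: certificate_def)
  then have "rat_poly p \<in> set (map rat_poly (spread m ps))"
    by (force simp: spread_def)
  with rat_poly_nonzero[OF p(3,2)] sum show ?thesis
    unfolding q_difference_equation_def in_set_conv_nth by auto
qed


section \<open>The partition of a sequence\<close>

lemma phi_plus_power: "(phi_plus ^^ k) \<alpha> = map (\<lambda>p. p + k) \<alpha>"
  by (induction k) (auto simp: phi_plus_def)

lemma mset_foldr_oplus: "mset (foldr (\<oplus>) xs []) = (\<Sum>x\<leftarrow>xs. mset x)"
  by (induction xs) (auto simp: oplus_def)

text \<open>Summands beyond the least bound are empty, so any bound serves. A sequence and its tail
  can then be summed with bounds that differ by exactly one.\<close>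

lemma mset_pi_bullet:
  assumes "\<And>j. j \<ge> N \<Longrightarrow> \<pi> (s j) = []"
  shows "mset (pi_bullet m \<pi> s) = (\<Sum>j<N. image_mset (\<lambda>p. p + m * j) (mset (\<pi> (s j))))"
proof -
  define L where "L = (LEAST N. \<forall>j\<ge>N. \<pi> (s j) = [])"
  have L: "\<forall>j\<ge>L. \<pi> (s j) = []"
    unfolding L_def by (rule LeastI[of _ N]) (use assms in auto)
  have "L \<le> N"
    unfolding L_def by (rule Least_le) (use assms in auto)
  have "mset (pi_bullet m \<pi> s) = (\<Sum>j\<leftarrow>[0..<L]. image_mset (\<lambda>p. p + m * j) (mset (\<pi> (s j))))"
    by (simp add: pi_bullet_def L_def mset_foldr_oplus phi_plus_power o_def)
  also have "\<dots> = (\<Sum>j<L. image_mset (\<lambda>p. p + m * j) (mset (\<pi> (s j))))"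
    by (simp add: interv_sum_list_conv_sum_set_nat atLeast0LessThan)
  also have "\<dots> = (\<Sum>j<N. image_mset (\<lambda>p. p + m * j) (mset (\<pi> (s j))))"
    using \<open>L \<le> N\<close> L by (intro sum.mono_neutral_left) auto
  finally show ?thesis .
qed

lemma Seq_bound:
  assumes "s \<in> Seq I \<pi>"
  obtains N where "\<And>j. j \<ge> N \<Longrightarrow> \<pi> (s j) = []"
proof -
  have "finite {j. \<pi> (s j) \<noteq> []}"
    using assms by (simp add: Seq_def)
  then obtain N where "\<forall>j\<in>{j. \<pi> (s j) \<noteq> []}. j < N"
    unfolding finite_nat_set_iff_bounded by blast
  then have "\<And>j. j \<ge> N \<Longrightarrow> \<pi> (s j) = []"
    by (metis leD mem_Collect_eq)
  then show ?thesis by (rule that)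
qed

lemma Seq_Suc: "s \<in> Seq I \<pi> \<Longrightarrow> (\<lambda>j. s (Suc j)) \<in> Seq I \<pi>"
  unfolding Seq_def using finite_vimageI[of "{j. \<pi> (s j) \<noteq> []}" Suc] by (auto simp: vimage_def)

lemma Seq_case_nat:
  assumes "i \<in> I" "s \<in> Seq I \<pi>"
  shows "case_nat i s \<in> Seq I \<pi>"
proof -
  have "{j. \<pi> (case_nat i s j) \<noteq> []} \<subseteq> insert 0 (Suc ` {j. \<pi> (s j) \<noteq> []})"
  proof
    fix j assume "j \<in> {j. \<pi> (case_nat i s j) \<noteq> []}"
    then show "j \<in> insert 0 (Suc ` {j. \<pi> (s j) \<noteq> []})"
      by (cases j) auto
  qed
  moreover have "finite {j. \<pi> (s j) \<noteq> []}"
    using assms by (simp add: Seq_def)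
  ultimately have "finite {j. \<pi> (case_nat i s j) \<noteq> []}"
    by (meson finite_imageI finite_insert finite_subset)
  then show ?thesis
    using assms by (auto simp: Seq_def split: nat.splits)
qed

lemma mset_pi_bullet_Suc:
  assumes "s \<in> Seq I \<pi>"
  shows "mset (pi_bullet m \<pi> s) =
    mset (\<pi> (s 0)) + image_mset (\<lambda>p. p + m) (mset (pi_bullet m \<pi> (\<lambda>j. s (Suc j))))"
proof -
  obtain N where N: "\<And>j. j \<ge> N \<Longrightarrow> \<pi> (s j) = []"
    using Seq_bound[OF assms] by blast
  have im: "image_mset f (\<Sum>j\<in>A. g j) = (\<Sum>j\<in>A. image_mset f (g j))" for f :: "nat \<Rightarrow> nat" and g and A :: "nat set"
    by (induction A rule: infinite_finite_induct) auto
  have "mset (pi_bullet m \<pi> s) = (\<Sum>j<Suc N. image_mset (\<lambda>p. p + m * j) (mset (\<pi> (s j))))"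
    by (rule mset_pi_bullet) (simp add: N)
  also have "\<dots> = mset (\<pi> (s 0)) +
      (\<Sum>j<N. image_mset (\<lambda>p. p + m) (image_mset (\<lambda>p. p + m * j) (mset (\<pi> (s (Suc j))))))"
    by (simp add: sum.lessThan_Suc_shift image_mset.compositionality o_def algebra_simps del: sum.lessThan_Suc)
  also have "(\<Sum>j<N. image_mset (\<lambda>p. p + m) (image_mset (\<lambda>p. p + m * j) (mset (\<pi> (s (Suc j)))))) =
      image_mset (\<lambda>p. p + m) (mset (pi_bullet m \<pi> (\<lambda>j. s (Suc j))))"
    by (subst mset_pi_bullet[of N]) (simp_all add: N im)
  finally show ?thesis .
qed

lemma length_pi_bullet_Suc:
  "s \<in> Seq I \<pi> \<Longrightarrow> length (pi_bullet m \<pi> s) = length (\<pi> (s 0)) + length (pi_bullet m \<pi> (\<lambda>j. s (Suc j)))"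
  using arg_cong[OF mset_pi_bullet_Suc, of s I \<pi> size m] by simp

text \<open>Raising every part by \<open>m\<close> adds \<open>m\<close> for each part; in the
  generating function this is the substitution of x q^m for x.\<close>

lemma sum_list_pi_bullet_Suc:
  assumes "s \<in> Seq I \<pi>"
  shows "sum_list (pi_bullet m \<pi> s) = sum_list (\<pi> (s 0)) +
    (sum_list (pi_bullet m \<pi> (\<lambda>j. s (Suc j))) + m * length (pi_bullet m \<pi> (\<lambda>j. s (Suc j))))"
proof -
  have "sum_mset (image_mset (\<lambda>p. p + m) (mset xs)) = sum_list xs + m * length xs" for xs
    by (induction xs) auto
  with arg_cong[OF mset_pi_bullet_Suc[OF assms, of m], of sum_mset] show ?thesis
    by (simp add: sum_mset_sum_list)
qed

lemma Par_le_bounds: "\<alpha> \<in> Par_le m \<Longrightarrow> p \<in> set \<alpha> \<Longrightarrow> 0 < p \<and> p \<le> m"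
  by (auto simp: Par_le_def Par_def)

lemma Par_eqI: "\<alpha> \<in> Par \<Longrightarrow> \<beta> \<in> Par \<Longrightarrow> mset \<alpha> = mset \<beta> \<Longrightarrow> \<alpha> = \<beta>"
proof -
  assume "\<alpha> \<in> Par" "\<beta> \<in> Par" and mset: "mset \<alpha> = mset \<beta>"
  then have "sorted (rev \<alpha>)" "sorted (rev \<beta>)"
    by (auto simp: Par_def sorted_wrt_rev)
  then have "sort \<beta> = rev \<alpha>" "sort \<beta> = rev \<beta>"
    using mset by (simp_all add: properties_for_sort)
  then show ?thesis by simp
qed

text \<open>
  The parts of size at most \<open>m\<close> are those of the first summand, so that the sequence can be
  read off its partition letter by letter.
\<close>

lemma inj_on_pi_bullet:
  assumes \<pi>: "\<pi> \<in> I \<rightarrow> Par_le m" "inj_on \<pi> I"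
  shows "inj_on (pi_bullet m \<pi>) (Seq I \<pi>)"
proof (rule inj_onI)
  \<comment> \<open>Positivity makes the parts of the tail exceed \<open>m\<close> once they are
    raised by \<open>m\<close>, so that the filter below removes exactly these.\<close>
  have pos: "0 < p" if s: "s \<in> Seq I \<pi>" and p: "p \<in># mset (pi_bullet m \<pi> s)" for s p
  proof -
    obtain N where "\<And>j. j \<ge> N \<Longrightarrow> \<pi> (s j) = []"
      using Seq_bound[OF s] by blast
    then have "mset (pi_bullet m \<pi> s) = (\<Sum>j<N. image_mset (\<lambda>p. p + m * j) (mset (\<pi> (s j))))"
      by (rule mset_pi_bullet)
    with p obtain j q where "q \<in># mset (\<pi> (s j))" "p = q + m * j"
      by (auto simp: set_mset_sum simp del: set_mset_mset)
    moreover have "\<pi> (s j) \<in> Par_le m"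
      using \<pi> s by (auto simp: Seq_def)
    ultimately show ?thesis
      using Par_le_bounds by fastforce
  qed
  have filt: "filter_mset (\<lambda>p. p \<le> m) (mset (pi_bullet m \<pi> s)) = mset (\<pi> (s 0))"
    if s: "s \<in> Seq I \<pi>" for s
  proof -
    have "\<pi> (s 0) \<in> Par_le m"
      using \<pi> s by (auto simp: Seq_def)
    then have "filter_mset (\<lambda>p. p \<le> m) (mset (\<pi> (s 0))) = mset (\<pi> (s 0))"
      using Par_le_bounds by (auto simp: filter_mset_eq_conv)
    moreover have "filter_mset (\<lambda>p. p \<le> m)
        (image_mset (\<lambda>p. p + m) (mset (pi_bullet m \<pi> (\<lambda>j. s (Suc j))))) = {#}"
      using pos[OF Seq_Suc[OF s]] by fastforce
    ultimately show ?thesis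
      by (simp add: mset_pi_bullet_Suc[OF s])
  qed
  have "s j = t j" if "s \<in> Seq I \<pi>" "t \<in> Seq I \<pi>" "mset (pi_bullet m \<pi> s) = mset (pi_bullet m \<pi> t)" for s t j
    using that
  proof (induction j arbitrary: s t)
    case 0
    then have "mset (\<pi> (s 0)) = mset (\<pi> (t 0))"
      using filt by metis
    moreover have "\<pi> (s 0) \<in> Par" "\<pi> (t 0) \<in> Par" "s 0 \<in> I" "t 0 \<in> I"
      using \<pi> 0 by (auto simp: Seq_def Par_le_def)
    ultimately show ?case
      using Par_eqI \<pi>(2) by (metis inj_onD)
  next
    case (Suc j)
    have "mset (\<pi> (s 0)) = mset (\<pi> (t 0))"
      using filt Suc.prems by metis
    then have "image_mset (\<lambda>p. p + m) (mset (pi_bullet m \<pi> (\<lambda>j. s (Suc j)))) =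
        image_mset (\<lambda>p. p + m) (mset (pi_bullet m \<pi> (\<lambda>j. t (Suc j))))"
      using Suc.prems mset_pi_bullet_Suc by (metis add_left_cancel)
    \<comment> \<open>Subtracting \<open>m\<close> undoes the shift of the tails.\<close>
    from arg_cong[OF this, of "image_mset (\<lambda>p. p - m)"]
    have "mset (pi_bullet m \<pi> (\<lambda>j. s (Suc j))) = mset (pi_bullet m \<pi> (\<lambda>j. t (Suc j)))"
      by (simp add: image_mset.compositionality o_def)
    with Suc.IH[OF Seq_Suc[OF Suc.prems(1)] Seq_Suc[OF Suc.prems(2)]] show ?case
      by simp
  qed
  then show "s = t" if "s \<in> Seq I \<pi>" "t \<in> Seq I \<pi>" "pi_bullet m \<pi> s = pi_bullet m \<pi> t" for s t
    using that by auto
qed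


section \<open>The avoidance automaton\<close>

text \<open>Failure is attached to transitions rather than states, so that a forbidden letter is
  simply a missing edge in \<open>edges\<close>.\<close>

definition alive :: "('v \<Rightarrow> nat \<Rightarrow> bool) \<Rightarrow> ('v \<Rightarrow> nat \<Rightarrow> 'v) \<Rightarrow> 'v \<Rightarrow> (nat \<Rightarrow> nat) \<Rightarrow> bool" where
  "alive bad nxt v s \<longleftrightarrow> (\<forall>j. \<not> bad (foldl nxt v (map s [0..<j])) (s j))"

definition live_seqs ::
  "nat set \<Rightarrow> (nat \<Rightarrow> nat list) \<Rightarrow> ('v \<Rightarrow> nat \<Rightarrow> bool) \<Rightarrow> ('v \<Rightarrow> nat \<Rightarrow> 'v) \<Rightarrow> 'v \<Rightarrow> (nat \<Rightarrow> nat) set" where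
  "live_seqs I \<pi> bad nxt v = {s\<in>Seq I \<pi>. alive bad nxt v s}"

definition edges ::
  "nat list \<Rightarrow> (nat \<Rightarrow> nat list) \<Rightarrow> ('v \<Rightarrow> nat \<Rightarrow> bool) \<Rightarrow> ('v \<Rightarrow> nat \<Rightarrow> 'v) \<Rightarrow> 'v wgraph" where
  "edges Is \<pi> bad nxt v =
     concat (map (\<lambda>i. if bad v i then [] else [(length (\<pi> i), sum_list (\<pi> i), nxt v i)]) Is)"

lemma alive_Suc:
  "alive bad nxt v s \<longleftrightarrow> \<not> bad v (s 0) \<and> alive bad nxt (nxt v (s 0)) (\<lambda>j. s (Suc j))"
proof -
  have map: "map s [0..<Suc j] = s 0 # map (\<lambda>j. s (Suc j)) [0..<j]" for j
    by (rule nth_equalityI) (auto simp: nth_Cons split: nat.splits simp del: upt_Suc)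
  have "(\<forall>j. P j) \<longleftrightarrow> P 0 \<and> (\<forall>j. P (Suc j))" for P :: "nat \<Rightarrow> bool"
    by (metis not0_implies_Suc)
  then have "alive bad nxt v s \<longleftrightarrow> \<not> bad (foldl nxt v (map s [0..<0])) (s 0) \<and>
      (\<forall>j. \<not> bad (foldl nxt v (map s [0..<Suc j])) (s (Suc j)))"
    unfolding alive_def .
  then show ?thesis
    unfolding map by (simp add: alive_def)
qed

text \<open>Injectivity transfers finiteness from the lists of given length with bounded entries.
  Cardinalities can be added over a disjoint union only after this, since \<open>card\<close> is 0
  on infinite sets.\<close>

lemma finite_pi_bullet_fiber:
  assumes "\<pi> \<in> I \<rightarrow> Par_le m" "inj_on \<pi> I" "S \<subseteq> Seq I \<pi>"
  shows "finite {s\<in>S. length (pi_bullet m \<pi> s) = a \<and> sum_list (pi_bullet m \<pi> s) = n}"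
proof (rule finite_imageD)
  have "pi_bullet m \<pi> ` {s\<in>S. length (pi_bullet m \<pi> s) = a \<and> sum_list (pi_bullet m \<pi> s) = n} \<subseteq>
      {\<alpha>. set \<alpha> \<subseteq> {..n} \<and> length \<alpha> = a}"
    using member_le_sum_list by auto
  then show "finite (pi_bullet m \<pi> ` {s\<in>S. length (pi_bullet m \<pi> s) = a \<and> sum_list (pi_bullet m \<pi> s) = n})"
    by (rule finite_subset) (simp add: finite_lists_length_eq)
  show "inj_on (pi_bullet m \<pi>) {s\<in>S. length (pi_bullet m \<pi> s) = a \<and> sum_list (pi_bullet m \<pi> s) = n}"
    using inj_on_pi_bullet[OF assms(1,2)] by (rule inj_on_subset) (use assms(3) in auto)
qed

lemma nth_gen_fun_pi_bullet:
  assumes "\<pi> \<in> I \<rightarrow> Par_le m" "inj_on \<pi> I" "S \<subseteq> Seq I \<pi>"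
  shows "fps_nth (fps_nth (gen_fun (pi_bullet m \<pi> ` S)) a) n =
    of_nat (card {s\<in>S. length (pi_bullet m \<pi> s) = a \<and> sum_list (pi_bullet m \<pi> s) = n})"
proof -
  have "{\<alpha>\<in>pi_bullet m \<pi> ` S. length \<alpha> = a \<and> sum_list \<alpha> = n} =
      pi_bullet m \<pi> ` {s\<in>S. length (pi_bullet m \<pi> s) = a \<and> sum_list (pi_bullet m \<pi> s) = n}"
    by auto
  moreover have "inj_on (pi_bullet m \<pi>) {s\<in>S. length (pi_bullet m \<pi> s) = a \<and> sum_list (pi_bullet m \<pi> s) = n}"
    using inj_on_pi_bullet[OF assms(1,2)] by (rule inj_on_subset) (use assms(3) in auto)
  ultimately show ?thesis
    by (simp add: gen_fun_def card_image)
qed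

text \<open>Surviving sequences are split by their first letter, that is, by the first edge they
  take. Injectivity of \<open>pi_bullet\<close> allows counting them in place of their
  partitions.\<close>

lemma gen_fun_live_seqs:
  fixes bad :: "'v \<Rightarrow> nat \<Rightarrow> bool" and nxt :: "'v \<Rightarrow> nat \<Rightarrow> 'v"
  assumes \<pi>: "\<pi> \<in> I \<rightarrow> Par_le m" "inj_on \<pi> I" and Is: "set Is = I" "distinct Is"
  defines "S \<equiv> live_seqs I \<pi> bad nxt"
  defines "G \<equiv> \<lambda>v. gen_fun (pi_bullet m \<pi> ` S v)"
  shows "G v = (\<Sum>(l, s, v')\<leftarrow>edges Is \<pi> bad nxt v. fps_X ^ l * fpsQ ^ s * q_shift m (G v'))"
proof (intro fps_ext)
  fix a n
  define L where "L s = length (pi_bullet m \<pi> s)" for s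
  define W where "W s = sum_list (pi_bullet m \<pi> s)" for s
  define good where "good = {i\<in>I. \<not> bad v i}"
  have sub: "S v \<subseteq> Seq I \<pi>" for v
    by (auto simp: S_def live_seqs_def)
  have fin: "finite {s\<in>S v. L s = a \<and> W s = n}" for v a n
    unfolding L_def W_def by (rule finite_pi_bullet_fiber[OF \<pi> sub])
  have nth: "fps_nth (fps_nth (G v) a) n = of_nat (card {s\<in>S v. L s = a \<and> W s = n})" for v a n
    unfolding L_def W_def G_def by (rule nth_gen_fun_pi_bullet[OF \<pi> sub])
  \<comment> \<open>The tails that may follow the letter \<open>i\<close>. Solved for the length and
    sum of the tail, the two conditions describe either the empty set or a fibre of the same kind at
    the next state.\<close>
  define B where "B i = {s\<in>S (nxt v i). length (\<pi> i) + L s = a \<and> sum_list (\<pi> i) + (W s + m * L s) = n}" for i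
  have B: "B i = (if length (\<pi> i) \<le> a \<and> sum_list (\<pi> i) + m * (a - length (\<pi> i)) \<le> n
      then {s\<in>S (nxt v i). L s = a - length (\<pi> i) \<and>
        W s = n - (sum_list (\<pi> i) + m * (a - length (\<pi> i)))} else {})" for i
    by (auto simp: B_def)
  have "{s\<in>S v. L s = a \<and> W s = n} = (\<Union>i\<in>good. case_nat i ` B i)"
  proof (intro equalityI subsetI)
    fix s assume s: "s \<in> {s\<in>S v. L s = a \<and> W s = n}"
    then have seq: "s \<in> Seq I \<pi>"
      using sub by auto
    have "(\<lambda>j. s (Suc j)) \<in> B (s 0)" "s 0 \<in> good"
      using s length_pi_bullet_Suc[OF seq, of m] sum_list_pi_bullet_Suc[OF seq, of m] seq
        Seq_Suc[OF seq] alive_Suc[of bad nxt v s]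
      by (auto simp: B_def good_def S_def live_seqs_def L_def W_def) (auto simp: Seq_def)
    moreover have "s = case_nat (s 0) (\<lambda>j. s (Suc j))"
      by (auto split: nat.splits)
    ultimately show "s \<in> (\<Union>i\<in>good. case_nat i ` B i)"
      by blast
  next
    fix s assume "s \<in> (\<Union>i\<in>good. case_nat i ` B i)"
    then obtain i t where it: "i \<in> good" "t \<in> B i" "s = case_nat i t"
      by blast
    then have seq: "s \<in> Seq I \<pi>"
      using sub by (auto simp: B_def good_def intro!: Seq_case_nat)
    show "s \<in> {s\<in>S v. L s = a \<and> W s = n}"
      using it length_pi_bullet_Suc[OF seq, of m] sum_list_pi_bullet_Suc[OF seq, of m] seq
        alive_Suc[of bad nxt v s]
      by (auto simp: B_def good_def S_def live_seqs_def L_def W_def)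
  qed
  then have "card {s\<in>S v. L s = a \<and> W s = n} = card (\<Union>i\<in>good. case_nat i ` B i)"
    by simp
  also have "\<dots> = (\<Sum>i\<in>good. card (case_nat i ` B i))"
  proof (rule card_UN_disjoint)
    show "finite good"
      using Is by (auto simp: good_def)
    show "\<forall>i\<in>good. finite (case_nat i ` B i)"
      using fin by (auto simp: B)
    have "i = j" if "case_nat i s = case_nat j t" for i j s and t :: "nat \<Rightarrow> nat"
      using fun_cong[OF that, of 0] by simp
    then show "\<forall>i\<in>good. \<forall>j\<in>good. i \<noteq> j \<longrightarrow> case_nat i ` B i \<inter> case_nat j ` B j = {}"
      by blast
  qed
  also have "\<dots> = (\<Sum>i\<in>good. card (B i))"
  proof (intro sum.cong refl card_image inj_onI)
    fix i and s t :: "nat \<Rightarrow> nat"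
    assume "case_nat i s = case_nat i t"
    then show "s = t"
      by (metis nat.case(2) ext)
  qed
  finally have card: "card {s\<in>S v. L s = a \<and> W s = n} = (\<Sum>i\<in>good. card (B i))" .
  have coeff: "fps_nth (fps_nth (fps_X ^ length (\<pi> i) * fpsQ ^ sum_list (\<pi> i) *
      q_shift m (G (nxt v i))) a) n = of_nat (card (B i))" for i
  proof -
    have X: "fps_nth (fps_X ^ s * (fps_X ^ k * H)) n = (if s + k \<le> n then fps_nth H (n - (s + k)) else 0)"
      for s k and H :: "rat fps"
      unfolding mult.assoc[symmetric] power_add[symmetric] fps_X_power_mult_nth by auto
    show ?thesis
      by (simp add: mult.assoc fps_X_power_mult_nth nth_q_shift X nth B not_less)
  qed
  have "fps_nth (fps_nth (\<Sum>(l, s, v')\<leftarrow>edges Is \<pi> bad nxt v. fps_X ^ l * fpsQ ^ s * q_shift m (G v')) a) n =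
      (\<Sum>i\<leftarrow>Is. if bad v i then 0 else of_nat (card (B i)))"
    unfolding edges_def by (induction Is) (auto simp: coeff simp del: fps_const_power)
  also have "\<dots> = (\<Sum>i\<in>I. if bad v i then 0 else of_nat (card (B i)))"
    using Is by (simp add: sum_list_distinct_conv_sum_set)
  also have "\<dots> = (\<Sum>i\<in>good. of_nat (card (B i)))"
    using Is by (intro sum.mono_neutral_cong_right) (auto simp: good_def)
  finally show "fps_nth (fps_nth (G v) a) n =
      fps_nth (fps_nth (\<Sum>(l, s, v')\<leftarrow>edges Is \<pi> bad nxt v. fps_X ^ l * fpsQ ^ s * q_shift m (G v')) a) n"
    by (simp add: nth card)
qed

text \<open>
  A state consists of the states that the first automaton reaches from \<open>q\<close> along the nonempty
  suffixes of the word read so far, and of the state that the second one reaches along the whole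
  word. Listing the former in the order of \<open>Qs\<close> makes the states canonical.
\<close>

definition avoid_next ::
  "nat list \<Rightarrow> nat \<Rightarrow> (nat \<Rightarrow> nat \<Rightarrow> nat) \<Rightarrow> (nat \<Rightarrow> nat \<Rightarrow> nat) \<Rightarrow> nat list \<times> nat \<Rightarrow> nat \<Rightarrow> nat list \<times> nat" where
  "avoid_next Qs q st st' v i =
     (filter (\<lambda>r. r \<in> set (map (\<lambda>p. st p i) (q # fst v))) Qs, st' (snd v) i)"

definition avoid_bad :: "nat list \<Rightarrow> nat list \<Rightarrow> ('a \<Rightarrow> nat \<Rightarrow> nat list \<times> nat) \<Rightarrow> 'a \<Rightarrow> nat \<Rightarrow> bool" where
  "avoid_bad F F' nxt v i \<longleftrightarrow> (\<exists>r\<in>set (fst (nxt v i)). r \<in> set F) \<or> snd (nxt v i) \<in> set F'"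

lemma foldl_avoid_next:
  assumes st: "\<And>p i. p \<in> set Qs \<Longrightarrow> i \<in> I \<Longrightarrow> st p i \<in> set Qs" and q: "q \<in> set Qs" and s: "\<And>j. s j \<in> I"
  shows "set (fst (foldl (avoid_next Qs q st st') ([], q') (map s [0..<n]))) =
      (\<lambda>a. foldl st q (map s [a..<n])) ` {..<n} \<and>
    snd (foldl (avoid_next Qs q st st') ([], q') (map s [0..<n])) = foldl st' q' (map s [0..<n])"
proof (induction n)
  case (Suc n)
  let ?v = "foldl (avoid_next Qs q st st') ([], q') (map s [0..<n])"
  have Qs: "foldl st q (map s [a..<b]) \<in> set Qs" for a b
    by (induction b) (auto simp: q s st)
  have "set (fst (foldl (avoid_next Qs q st st') ([], q') (map s [0..<Suc n]))) =
      insert (st q (s n)) ((\<lambda>p. st p (s n)) ` set (fst ?v)) \<inter> set Qs"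
    by (auto simp: avoid_next_def)
  also have "\<dots> = insert (st q (s n)) ((\<lambda>a. foldl st q (map s [a..<Suc n])) ` {..<n}) \<inter> set Qs"
    using Suc by (auto simp: image_image)
  \<comment> \<open>The runs stay inside \<open>Qs\<close>, so filtering by \<open>Qs\<close> loses
    nothing.\<close>
  also have "\<dots> = insert (st q (s n)) ((\<lambda>a. foldl st q (map s [a..<Suc n])) ` {..<n})"
    using st[OF q s, of n] st[OF Qs s] by auto
  also have "\<dots> = (\<lambda>a. foldl st q (map s [a..<Suc n])) ` {..<Suc n}"
    by (simp add: lessThan_Suc)
  finally show ?case
    using Suc by (simp add: avoid_next_def)
qed simp

text \<open>A block of \<open>s\<close> is a suffix of a prefix and is detected when its last letter
  is read. Every forbidden word has a last letter, because neither automaton accepts the empty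
  word.\<close>

lemma alive_avoid:
  fixes st st' :: "nat \<Rightarrow> nat \<Rightarrow> nat"
  assumes st: "\<And>p i. p \<in> set Qs \<Longrightarrow> i \<in> I \<Longrightarrow> st p i \<in> set Qs" and q: "q \<in> set Qs" and s: "\<And>j. s j \<in> I"
    and nonempty: "q \<notin> set F" "q' \<notin> set F'"
  defines "nxt \<equiv> avoid_next Qs q st st'"
  shows "alive (avoid_bad F F' nxt) nxt ([], q') s \<longleftrightarrow>
    (\<forall>w\<in>{w\<in>lists I. foldl st q w \<in> set F}. \<not> matches s w) \<and>
    (\<forall>w\<in>{w\<in>lists I. foldl st' q' w \<in> set F'}. \<not> begins_with s w)"
proof -
  have step: "nxt (foldl nxt v (map s [0..<j])) (s j) = foldl nxt v (map s [0..<Suc j])" for v j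
    by simp
  have inv: "set (fst (foldl nxt ([], q') (map s [0..<n]))) = (\<lambda>a. foldl st q (map s [a..<n])) ` {..<n}"
    "snd (foldl nxt ([], q') (map s [0..<n])) = foldl st' q' (map s [0..<n])" for n
    using foldl_avoid_next[of Qs I st q s st' q' n] st q s unfolding nxt_def by auto
  have lists: "map s xs \<in> lists I" for xs
    using s by auto
  have "alive (avoid_bad F F' nxt) nxt ([], q') s \<longleftrightarrow>
      (\<forall>j. \<forall>a<Suc j. foldl st q (map s [a..<Suc j]) \<notin> set F) \<and>
      (\<forall>j. foldl st' q' (map s [0..<Suc j]) \<notin> set F')"
    unfolding alive_def avoid_bad_def step inv by blast
  also have "(\<forall>j. \<forall>a<Suc j. foldl st q (map s [a..<Suc j]) \<notin> set F) \<longleftrightarrow>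
      (\<forall>w\<in>{w\<in>lists I. foldl st q w \<in> set F}. \<not> matches s w)" (is "?A \<longleftrightarrow> ?B")
  proof
    assume A: ?A
    show ?B
    proof (intro ballI notI)
      fix w assume w: "w \<in> {w\<in>lists I. foldl st q w \<in> set F}" "matches s w"
      then obtain a where a: "map s [a..<a + length w] = w"
        by (auto simp: matches_def)
      have "w \<noteq> []"
        using w nonempty by auto
      then obtain k where "length w = Suc k"
        by (metis Suc_pred length_greater_0_conv)
      with a have "map s [a..<Suc (a + k)] = w"
        by (simp del: upt_Suc)
      with A[rule_format, of a "a + k"] w show False by auto
    qed
  next
    assume B: ?B
    show ?A
    proof (intro allI impI notI)
      fix j a assume "a < Suc j" and F: "foldl st q (map s [a..<Suc j]) \<in> set F"
      have "matches s (map s [a..<Suc j])"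
        unfolding matches_def using \<open>a < Suc j\<close> by (intro exI[of _ a]) simp
      with B F lists show False by blast
    qed
  qed
  also have "(\<forall>j. foldl st' q' (map s [0..<Suc j]) \<notin> set F') \<longleftrightarrow>
      (\<forall>w\<in>{w\<in>lists I. foldl st' q' w \<in> set F'}. \<not> begins_with s w)" (is "?A \<longleftrightarrow> ?B")
  proof
    assume A: ?A
    show ?B
    proof (intro ballI notI)
      fix w assume w: "w \<in> {w\<in>lists I. foldl st' q' w \<in> set F'}" "begins_with s w"
      have "w \<noteq> []"
        using w nonempty by auto
      then obtain k where "length w = Suc k"
        by (metis Suc_pred length_greater_0_conv)
      with A[rule_format, of k] w show False
        by (simp add: begins_with_def del: upt_Suc)
    qed
  next
    assume B: ?B
    show ?A
    proof (intro allI notI)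
      fix j assume F: "foldl st' q' (map s [0..<Suc j]) \<in> set F'"
      have "begins_with s (map s [0..<Suc j])"
        unfolding begins_with_def by simp
      with B F lists show False by blast
    qed
  qed
  finally show ?thesis .
qed


section \<open>The algorithm\<close>

definition position :: "nat list \<Rightarrow> nat \<Rightarrow> nat" where
  "position ks k = foldr (\<lambda>r n. if r = k then 0 else Suc n) ks 0"

text \<open>An absent key gets position \<open>length ks\<close>, and an exhausted list of values
  yields \<open>hd []\<close>. Lookups are thus total, and for fixed lists they take finitely many
  values.\<close>

definition lookup :: "nat list \<Rightarrow> nat list \<Rightarrow> nat \<Rightarrow> nat" where
  "lookup ks vs k = hd (drop (position ks k) vs)"

definition field :: "nat \<Rightarrow> nat \<Rightarrow> nat" where
  "field k n = hd (drop k (list_decode n))"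

definition table_step :: "nat list \<Rightarrow> nat \<Rightarrow> nat \<Rightarrow> nat \<Rightarrow> nat" where
  "table_step Is D p i =
     lookup Is (list_decode (lookup (list_decode (field 0 D)) (list_decode (field 3 D)) p)) i"

text \<open>
  The functions below apply to every number, also to those that encode no input, because
  the search has to terminate on all of them.
\<close>

definition code_letters :: "nat \<Rightarrow> nat list" where
  "code_letters n = list_decode (field 1 n)"

definition code_pi :: "nat \<Rightarrow> nat \<Rightarrow> nat list" where
  "code_pi n i = list_decode (lookup (code_letters n) (list_decode (field 2 n)) i)"

definition code_next :: "nat \<Rightarrow> nat list \<times> nat \<Rightarrow> nat \<Rightarrow> nat list \<times> nat" where
  "code_next n = avoid_next (list_decode (field 0 (field 3 n))) (field 1 (field 3 n))
     (table_step (code_letters n) (field 3 n)) (table_step (code_letters n) (field 4 n))"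

definition code_bad :: "nat \<Rightarrow> nat list \<times> nat \<Rightarrow> nat \<Rightarrow> bool" where
  "code_bad n = avoid_bad (list_decode (field 2 (field 3 n))) (list_decode (field 2 (field 4 n)))
     (code_next n)"

definition code_edges :: "nat \<Rightarrow> (nat list \<times> nat) wgraph" where
  "code_edges n = edges (code_letters n) (code_pi n) (code_bad n) (code_next n)"

definition code_start :: "nat \<Rightarrow> nat list \<times> nat" where
  "code_start n = ([], field 1 (field 4 n))"

definition code_certificate :: "nat \<Rightarrow> cpoly list \<Rightarrow> bool" where
  "code_certificate n ps \<longleftrightarrow> certificate (code_edges n) (field 0 n) (code_start n) ps"

text \<open>This is \<open>int_encode (coef c)\<close>, with doubling written as addition: even
  codes for nonnegative integers, odd codes for negative ones.\<close>

definition coef_code :: "nat \<times> nat \<Rightarrow> nat" where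
  "coef_code c = (if snd c \<le> fst c then (fst c - snd c) + (fst c - snd c)
     else Suc ((snd c - fst c - 1) + (snd c - fst c - 1)))"

text \<open>The constant 2 is \<open>int_encode 1\<close>, the denominator of an integer.\<close>

definition code_output :: "nat \<Rightarrow> cpoly list \<Rightarrow> (nat \<times> nat) list list list" where
  "code_output n ps = map (map (map (\<lambda>c. (coef_code c, 2)))) (spread (field 0 n) ps)"

section \<open>Computability of the test and of the output\<close>

lemma cmp_mult [cmp_intros]:
  fixes f g :: "'a::encodable \<Rightarrow> nat"
  shows "cmp f \<Longrightarrow> cmp g \<Longrightarrow> cmp (\<lambda>x. f x * g x)"
proof -
  have eq: "a * b = rec_nat 0 (\<lambda>_ r. r + b) a" for a b :: nat
    by (induction a) auto
  assume "cmp f" "cmp g"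
  then show ?thesis
    unfolding eq by (intro cmp_intros cmp_comp[OF \<open>cmp g\<close>])
qed

lemma cmp_last [cmp_intros]: "cmp xs \<Longrightarrow> cmp (\<lambda>x. last (xs x))"
proof -
  have eq: "last ys = (if ys = [] then last [] else hd (rev ys))" for ys :: "'b list"
    by (simp add: hd_rev)
  assume "cmp xs"
  then have "cmp (\<lambda>x. if xs x = [] then last [] else hd (rev (xs x)))"
    by (intro cmp_intros)
  then show ?thesis
    by (simp flip: eq)
qed

lemma cmp_field [cmp_intros]: "cmp f \<Longrightarrow> cmp (\<lambda>x. field k (f x))"
  unfolding field_def by (intro cmp_intros)

lemma cmp_lookup [cmp_intros]:
  assumes "cmp f" "cmp g" "cmp h"
  shows "cmp (\<lambda>x. lookup (f x) (g x) (h x))"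
  unfolding lookup_def position_def using assms by (intro cmp_intros cmp_comp[OF assms(3)])

lemma cmp_code_letters [cmp_intros]: "cmp f \<Longrightarrow> cmp (\<lambda>x. code_letters (f x))"
  unfolding code_letters_def by (intro cmp_intros)

lemma cmp_code_pi [cmp_intros]: "cmp f \<Longrightarrow> cmp g \<Longrightarrow> cmp (\<lambda>x. code_pi (f x) (g x))"
  unfolding code_pi_def by (intro cmp_intros)

lemma cmp_table_step [cmp_intros]:
  "cmp f \<Longrightarrow> cmp g \<Longrightarrow> cmp h \<Longrightarrow> cmp k \<Longrightarrow> cmp (\<lambda>x. table_step (f x) (g x) (h x) (k x))"
  unfolding table_step_def by (intro cmp_intros)

lemma cmp_code_next: "cmp (\<lambda>x. code_next (fst x) (fst (snd x)) (snd (snd x)))"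
  unfolding code_next_def avoid_next_def by (intro cmp_intros)

lemma cmp_code_next' [cmp_intros]:
  "cmp f \<Longrightarrow> cmp g \<Longrightarrow> cmp h \<Longrightarrow> cmp (\<lambda>x. code_next (f x) (g x) (h x))"
  using cmp_comp[OF cmp_code_next, of "\<lambda>x. (f x, g x, h x)"] by (simp add: cmp_Pair)

lemma dcd_code_bad: "dcd (\<lambda>x. code_bad (fst x) (fst (snd x)) (snd (snd x)))"
  unfolding code_bad_def avoid_bad_def by (intro cmp_intros)

lemma dcd_code_bad' [cmp_intros]:
  "cmp f \<Longrightarrow> cmp g \<Longrightarrow> cmp h \<Longrightarrow> dcd (\<lambda>x. code_bad (f x) (g x) (h x))"
  using dcd_comp[OF dcd_code_bad, of "\<lambda>x. (f x, g x, h x)"] by (simp add: cmp_Pair)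

lemma cmp_code_edges: "cmp (\<lambda>x. code_edges (fst x) (snd x))"
  unfolding code_edges_def edges_def by (intro cmp_intros)

lemma cmp_code_edges' [cmp_intros]: "cmp f \<Longrightarrow> cmp g \<Longrightarrow> cmp (\<lambda>x. code_edges (f x) (g x))"
  using cmp_comp[OF cmp_code_edges, of "\<lambda>x. (f x, g x)"] by (simp add: cmp_Pair)

lemma cmp_code_start [cmp_intros]: "cmp f \<Longrightarrow> cmp (\<lambda>x. code_start (f x))"
  unfolding code_start_def by (intro cmp_intros)

lemma cmp_start_terms: "cmp (\<lambda>x::(nat list \<times> nat) \<times> cpoly. start_terms (fst x) (snd x))"
  unfolding start_terms_def row_terms_def split_def by (intro cmp_intros)

lemma cmp_extend_terms:
  "cmp (\<lambda>x::nat \<times> nat \<times> (nat list \<times> nat) wterm list.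
     extend_terms (code_edges (fst x)) (fst (snd x)) (snd (snd x)))"
  unfolding extend_terms_def split_def by (intro cmp_intros)

lemma cmp_run_terms:
  "cmp (\<lambda>x. run_terms (code_edges (fst x)) (field 0 (fst x)) (code_start (fst x)) (snd x))"
proof -
  have ext: "cmp (\<lambda>x. extend_terms (code_edges (f x)) (g x) (h x))" if "cmp f" "cmp g" "cmp h"
    for f g and h :: "'b::encodable \<Rightarrow> _"
    using cmp_comp[OF cmp_extend_terms, of "\<lambda>x. (f x, g x, h x)"] that by (simp add: cmp_Pair)
  have start: "cmp (\<lambda>x. start_terms (f x) (g x))" if "cmp f" "cmp g"
    for f :: "'b::encodable \<Rightarrow> nat list \<times> nat" and g
    using cmp_comp[OF cmp_start_terms, of "\<lambda>x. (f x, g x)"] that by (simp add: cmp_Pair)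
  show ?thesis
    unfolding run_terms_def split_def by (intro cmp_intros ext start)
qed

lemma dcd_zero_terms: "dcd (zero_terms :: (nat list \<times> nat) wterm list \<Rightarrow> bool)"
  unfolding zero_terms_def[abs_def] by (intro cmp_intros)

lemma dcd_normal_cpoly: "dcd normal_cpoly"
  unfolding normal_cpoly_def[abs_def] by (intro cmp_intros)

lemma dcd_code_certificate: "dcd (\<lambda>x. code_certificate (fst x) (snd x))"
  unfolding code_certificate_def certificate_def
  by (intro cmp_intros dcd_comp[OF dcd_zero_terms] dcd_comp[OF dcd_normal_cpoly] cmp_run_terms)

lemma cmp_code_output: "cmp (\<lambda>x. code_output (fst x) (snd x))"
  unfolding code_output_def spread_def coef_code_def by (intro cmp_intros)

section \<open>Termination of the search\<close>

lemma position_le: "position ks k \<le> length ks"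
  unfolding position_def by (induction ks) auto

text \<open>Positions are bounded by the lengths of the key lists, so only finitely many table
  entries can ever be read, even from meaningless data. This bounds the second component of the
  states.\<close>

lemma finite_table_step: "finite (range (\<lambda>(p, i). table_step Is D p i))"
proof (rule finite_subset)
  show "range (\<lambda>(p, i). table_step Is D p i) \<subseteq>
      (\<lambda>(j, k). hd (drop k (list_decode (hd (drop j (list_decode (field 3 D))))))) `
        ({..length (list_decode (field 0 D))} \<times> {..length Is})"
    using position_le by (force simp: table_step_def lookup_def)
qed simp

text \<open>The tables in an arbitrary number need not describe automata, yet the states are
  confined: the first component is filtered out of a fixed list, and the second is the initial state
  or a table entry.\<close>

lemma code_certificate_exists: "\<exists>ps. code_certificate n ps"
proof -
  define Qs where "Qs = list_decode (field 0 (field 3 n))"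
  define V where "V = {T. set T \<subseteq> set Qs \<and> length T \<le> length Qs} \<times>
    insert (field 1 (field 4 n)) (range (\<lambda>(p, i). table_step (code_letters n) (field 4 n) p i))"
  have "finite V"
    unfolding V_def by (intro finite_cartesian_product finite_lists_length_le finite.insertI
        finite_table_step finite_set)
  moreover have "code_start n \<in> V"
    by (simp add: code_start_def V_def)
  moreover have "v' \<in> V" if "(l, s, v') \<in> set (code_edges n v)" for l s v v'
  proof -
    from that obtain i where "v' = code_next n v i"
      by (auto simp: code_edges_def edges_def split: if_splits)
    then show ?thesis
      by (auto simp: code_next_def avoid_next_def V_def Qs_def)
  qed
  ultimately show ?thesis
    unfolding code_certificate_def by (rule certificate_exists)
qed

section \<open>Reading the input back\<close>

lemma lookup_map: "k \<in> set ks \<Longrightarrow> lookup ks (map f ks) k = f k"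
  unfolding lookup_def position_def by (induction ks) auto

lemma field_list_encode: "k < length xs \<Longrightarrow> field k (list_encode xs) = xs ! k"
  by (simp add: field_def hd_drop_conv_nth)

lemma lookup_encode_fun:
  "finite S \<Longrightarrow> k \<in> S \<Longrightarrow> lookup (sorted_list_of_set S) (list_decode (encode_fun S f)) k = f k"
  by (simp add: encode_fun_def lookup_map)

lemma field_encode_input:
  "field 0 (encode_input m I \<pi> M M') = m"
  "field (Suc 0) (encode_input m I \<pi> M M') = encode_set I"
  "field 2 (encode_input m I \<pi> M M') = encode_fun I (\<lambda>i. list_encode (\<pi> i))"
  "field 3 (encode_input m I \<pi> M M') = encode_dfa I M"
  "field 4 (encode_input m I \<pi> M M') = encode_dfa I M'"
  unfolding encode_input_def by (simp_all add: field_list_encode del: list_encode.simps)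

lemma field_encode_dfa:
  "field 0 (encode_dfa I M) = encode_set (dfa_states M)"
  "field (Suc 0) (encode_dfa I M) = dfa_init M"
  "field 2 (encode_dfa I M) = encode_set (dfa_final M)"
  "field 3 (encode_dfa I M) = encode_fun (dfa_states M) (\<lambda>p. encode_fun I (dfa_step M p))"
  unfolding encode_dfa_def by (simp_all add: field_list_encode del: list_encode.simps)

lemma table_step_encode:
  assumes "finite I" "finite (dfa_states M)" "p \<in> dfa_states M" "i \<in> I"
  shows "table_step (sorted_list_of_set I) (encode_dfa I M) p i = dfa_step M p i"
  using assms by (simp add: table_step_def field_encode_dfa encode_set_def lookup_encode_fun)

text \<open>The table agrees with \<open>dfa_step\<close> only on genuine states and letters;
  \<open>is_dfa\<close> keeps every run over \<open>I\<close> inside that domain.\<close>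

lemma dfa_lang_table_step:
  assumes "finite I" "is_dfa I M"
  shows "dfa_lang I M =
    {w\<in>lists I. foldl (table_step (sorted_list_of_set I) (encode_dfa I M)) (dfa_init M) w \<in> dfa_final M}"
proof -
  have "foldl (table_step (sorted_list_of_set I) (encode_dfa I M)) p w = foldl (dfa_step M) p w"
    if "p \<in> dfa_states M" "w \<in> lists I" for p w
    using that
  proof (induction w arbitrary: p)
    case (Cons i w)
    have "table_step (sorted_list_of_set I) (encode_dfa I M) p i = dfa_step M p i"
      using Cons.prems assms by (intro table_step_encode) (auto simp: is_dfa_def)
    moreover have "dfa_step M p i \<in> dfa_states M"
      using Cons.prems assms by (auto simp: is_dfa_def)
    ultimately show ?case
      using Cons by simp
  qed simp
  then show ?thesis
    using assms(2) unfolding dfa_lang_def is_dfa_def by (intro Collect_cong conj_cong refl) metis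
qed

section \<open>Encoding the output\<close>

lemma coef_code: "prod_encode (coef_code c, 2) = encode_rat (of_int (coef c))"
proof -
  have "coef_code c = int_encode (coef c)"
    by (auto simp: coef_code_def coef_def int_encode_def sum_encode_def nat_diff_distrib)
  then show ?thesis
    by (simp add: encode_rat_def int_encode_def sum_encode_def)
qed

lemma coeffs_Poly_normal: "xs = [] \<or> last xs \<noteq> 0 \<Longrightarrow> coeffs (Poly xs) = xs"
  by (cases xs rule: rev_cases) (auto simp: strip_while_def)

text \<open>Normality prevents zeros from being stripped by \<open>coeffs\<close>, both within the
  rows and from the list of rows, so the coded lists match entry by entry.\<close>

lemma encode_rat_poly:
  assumes "normal_cpoly p"
  shows "encode_poly (encode_poly encode_rat) (rat_poly p) = enc (map (map (\<lambda>c. (coef_code c, 2 :: nat))) p)"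
proof -
  define r :: "(nat \<times> nat) list \<Rightarrow> rat list" where "r row = map (\<lambda>c. of_int (coef c)) row" for row
  have coeffs: "coeffs (Poly (r row)) = r row" if "row \<in> set p" for row
    using assms that
    by (intro coeffs_Poly_normal) (auto simp: normal_cpoly_def r_def last_map coef_def)
  have "last (map (\<lambda>row. Poly (r row)) p) \<noteq> 0" if "p \<noteq> []"
  proof
    assume "last (map (\<lambda>row. Poly (r row)) p) = 0"
    then have "coeffs (Poly (r (last p))) = []"
      using that by (simp add: last_map)
    then have "r (last p) = []"
      using coeffs[of "last p"] last_in_set[OF that] by (simp only:)
    then have "last p = []"
      by (simp add: r_def)
    with assms that show False
      by (simp add: normal_cpoly_def)
  qed
  then have "coeffs (rat_poly p) = map (\<lambda>row. Poly (r row)) p"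
    unfolding rat_poly_def r_def[symmetric] by (intro coeffs_Poly_normal) auto
  then show ?thesis
    by (auto simp: encode_poly_def enc_list_def enc_prod_def enc_nat_def coeffs[unfolded r_def] r_def
        coef_code o_def simp del: coeffs_Poly intro!: arg_cong[of _ _ list_encode])
qed

lemma encode_output_code_output:
  assumes "\<And>p. p \<in> set ps \<Longrightarrow> normal_cpoly p"
  shows "enc (code_output n ps) = encode_output (map rat_poly (spread (field 0 n) ps))"
proof -
  have "normal_cpoly p" if "p \<in> set (spread (field 0 n) ps)" for p
    using that assms by (auto simp: spread_def normal_cpoly_def[of "[]"])
  then show ?thesis
    by (auto simp: encode_output_def code_output_def enc_list_def[of "map _ _"] encode_rat_poly o_def
        intro!: arg_cong[of _ _ list_encode])
qed

text \<open>For a genuine input the decoded tables are the given automata, so the survivors from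
  \<open>code_start\<close> are exactly \<open>avoid (Seq I \<pi>) X X'\<close>.\<close>

lemma code_certificate_sound:
  assumes linked: "regularly_linked_by C m I \<pi> X X'" and rec: "recognizes I M X" "recognizes I M' X'"
    and cert: "code_certificate (encode_input m I \<pi> M M') ps"
  shows "q_difference_equation (map rat_poly (spread m ps)) (gen_fun C)"
proof -
  define n where "n = encode_input m I \<pi> M M'"
  define Is where "Is = sorted_list_of_set I"
  have m: "m > 0" and I: "finite I" and \<pi>: "\<pi> \<in> I \<rightarrow> Par_le m" "inj_on \<pi> I"
    and X: "X \<subseteq> lists I - {[]}" "X' \<subseteq> lists I - {[]}"
    and C: "C = pi_bullet m \<pi> ` avoid (Seq I \<pi>) X X'"
    using linked by (auto simp: regularly_linked_by_def)
  have M: "is_dfa I M" "dfa_lang I M = X" and M': "is_dfa I M'" "dfa_lang I M' = X'"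
    using rec by (auto simp: recognizes_def)
  have fin: "finite (dfa_states M)" "finite (dfa_final M)" "finite (dfa_final M')"
    using M M' by (auto simp: is_dfa_def intro: finite_subset)
  have letters: "code_letters n = Is"
    by (simp add: code_letters_def n_def field_encode_input encode_set_def Is_def)
  have "code_pi n i = \<pi> i" if "i \<in> I" for i
    unfolding code_pi_def letters using that I
    by (simp add: Is_def n_def field_encode_input lookup_encode_fun)
  then have edges: "code_edges n = edges Is \<pi> (code_bad n) (code_next n)"
    unfolding code_edges_def edges_def letters using I
    by (auto simp: Is_def fun_eq_iff intro!: arg_cong[of _ _ concat])
  define st st' where "st = table_step Is (encode_dfa I M)" and "st' = table_step Is (encode_dfa I M')"
  define Qs F F' where "Qs = sorted_list_of_set (dfa_states M)"
    and "F = sorted_list_of_set (dfa_final M)" and "F' = sorted_list_of_set (dfa_final M')"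
  have sets: "set Qs = dfa_states M" "set F = dfa_final M" "set F' = dfa_final M'"
    using fin by (auto simp: Qs_def F_def F'_def)
  have X': "X = {w\<in>lists I. foldl st (dfa_init M) w \<in> set F}"
    "X' = {w\<in>lists I. foldl st' (dfa_init M') w \<in> set F'}"
    using dfa_lang_table_step[OF I M(1)] dfa_lang_table_step[OF I M'(1)] M M' sets
    by (auto simp: st_def st'_def Is_def)
  have start: "code_start n = ([], dfa_init M')"
    by (simp add: code_start_def n_def field_encode_input field_encode_dfa)
  have nxt: "code_next n = avoid_next Qs (dfa_init M) st st'"
    unfolding code_next_def letters
    by (simp add: n_def field_encode_input field_encode_dfa encode_set_def st_def st'_def Qs_def)
  have bad: "code_bad n = avoid_bad F F' (avoid_next Qs (dfa_init M) st st')"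
    unfolding code_bad_def nxt
    by (simp add: n_def field_encode_input field_encode_dfa encode_set_def F_def F'_def)
  have st: "st p i \<in> set Qs" if "p \<in> set Qs" "i \<in> I" for p i
    using that M(1) I sets fin by (simp add: st_def Is_def table_step_encode is_dfa_def)
  have init: "dfa_init M \<in> set Qs"
    using M(1) sets by (simp add: is_dfa_def)
  have nonempty: "dfa_init M \<notin> set F" "dfa_init M' \<notin> set F'"
  proof -
    have "[] \<notin> X" "[] \<notin> X'"
      using X by auto
    then show "dfa_init M \<notin> set F" "dfa_init M' \<notin> set F'"
      unfolding X' by auto
  qed
  have "alive (code_bad n) (code_next n) (code_start n) s \<longleftrightarrow>
      (\<forall>w\<in>X. \<not> matches s w) \<and> (\<forall>w\<in>X'. \<not> begins_with s w)" if "s \<in> Seq I \<pi>" for s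
    unfolding bad nxt start X'
    using that st init nonempty by (intro alive_avoid[where I = I]) (auto simp: Seq_def)
  then have "live_seqs I \<pi> (code_bad n) (code_next n) (code_start n) = avoid (Seq I \<pi>) X X'"
    by (auto simp: live_seqs_def avoid_def)
  moreover have "q_difference_equation (map rat_poly (spread m ps))
      (gen_fun (pi_bullet m \<pi> ` live_seqs I \<pi> (code_bad n) (code_next n) (code_start n)))"
  proof (rule certificate_sound[where E = "code_edges n"
        and G = "\<lambda>v. gen_fun (pi_bullet m \<pi> ` live_seqs I \<pi> (code_bad n) (code_next n) v)"])
    show "certificate (code_edges n) m (code_start n) ps"
      using cert by (simp add: code_certificate_def n_def field_encode_input)
    show "m > 0" by (rule m)
    show "gen_fun (pi_bullet m \<pi> ` live_seqs I \<pi> (code_bad n) (code_next n) v) =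
        (\<Sum>(l, s, v')\<leftarrow>code_edges n v. fps_X ^ l * fpsQ ^ s *
          q_shift m (gen_fun (pi_bullet m \<pi> ` live_seqs I \<pi> (code_bad n) (code_next n) v')))" for v
      unfolding edges using I by (intro gen_fun_live_seqs[OF \<pi>]) (auto simp: Is_def)
  qed
  ultimately show ?thesis
    by (simp add: C)
qed

theorem theorem1p5:
  shows "(\<forall>C. regularly_linked C \<longrightarrow> (\<exists>ps. q_difference_equation ps (gen_fun C))) \<and>
    (\<exists>A. computable A \<and>
       (\<forall>C m I \<pi> X X' M M'.
          regularly_linked_by C m I \<pi> X X' \<and> recognizes I M X \<and> recognizes I M' X' \<longrightarrow>
          (\<exists>ps. A (encode_input m I \<pi> M M') = encode_output ps \<and>
                q_difference_equation ps (gen_fun C))))"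
proof -
  \<comment> \<open>The search runs on every number; validity of the input enters through
    \<open>sound\<close> only.\<close>
  obtain f where f: "cmp f" "\<And>n. code_certificate n (f n)"
    using cmp_search[OF dcd_code_certificate code_certificate_exists] by blast
  have "cmp (\<lambda>n. code_output n (f n))"
    using cmp_comp[OF cmp_code_output, of "\<lambda>n. (n, f n)"] f(1) by (simp add: cmp_Pair cmp_id)
  then obtain A where A: "grec1 A" "\<And>n. A n = enc (code_output n (f n))"
    by (auto simp: cmp_def enc_nat_def)
  have sound: "\<exists>ps. A (encode_input m I \<pi> M M') = encode_output ps \<and> q_difference_equation ps (gen_fun C)"
    if "regularly_linked_by C m I \<pi> X X'" "recognizes I M X" "recognizes I M' X'" for C m I \<pi> X X' M M'
  proof -
    define n where "n = encode_input m I \<pi> M M'"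
    have "A n = encode_output (map rat_poly (spread m (f n)))"
      using f(2)[of n] encode_output_code_output[of "f n" n]
      by (simp add: A code_certificate_def certificate_def n_def field_encode_input)
    with code_certificate_sound[OF that f(2)] show ?thesis
      by (auto simp: n_def)
  qed
  \<comment> \<open>Regular languages come with automata, so the output of the algorithm also
    witnesses the existence statement.\<close>
  moreover have "\<exists>ps. q_difference_equation ps (gen_fun C)" if "regularly_linked C" for C
    using that sound unfolding regularly_linked_def regularly_linked_by_def regular_def by blast
  ultimately show ?thesis
    using A(1) unfolding computable_iff_grec1[symmetric] by blast
qed

end
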